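(* Let $A\in\mathcal B(H)^d$. If $0\in\mathcal W(A)$, then $\mathcal D_A^\circ=\mathcal W(A)$. Likewise, if $A\in\mathcal B(H)^d_{sa}$ and $0\in\mathcal W(A)$, then $(\mathcal D^{sa}_A)^\bullet=\mathcal W(A)$.
   Context: $\mathcal B(H)^d$ and $\mathcal B(H)^d_{sa}$ denote $d$-tuples of bounded, resp. bounded self-adjoint, operators on a complex Hilbert space $H$; $M_n^d$ and $(M_n)^d_{sa}$ denote $d$-tuples of complex, resp. self-adjoint, $n\times n$ matrices. $\operatorname{Re}T=\frac12(T+T^* )$. The matrix range is $\mathcal W(A)=\bigcup_n\mathcal W_n(A)$, $\mathcal W_n(A)=\{(\phi(A_1),\dots,\phi(A_d)):\phi:C^*(S_A)\to M_n\text{ unital completely positive}\}$, where $C^*(S_A)$ is the unital C*-algebra generated by $A$. The free spectrahedra are $\mathcal D_A=\bigcup_n\{X\in M_n^d:\operatorname{Re}(I-\sum_jA_j\otimes X_j)\ge0\}$ and, for self-adjoint $A$, $\mathcal D_A^{sa}=\bigcup_n\{X\in(M_n)^d_{sa}:I-\sum_jA_j\otimes X_j\ge0\}$. Polar duals: for $\mathcal S\subseteq\bigcup_nM_n^d$, $\mathcal S^\circ=\bigcup_n\{X\in M_n^d:\operatorname{Re}(\sum_jY_j\otimes X_j)\le I\ \forall Y\in\mathcal S\}$; for $\mathcal S\subseteq\bigcup_n(M_n)^d_{sa}$, $\mathcal S^\bullet=\bigcup_n\{X\in(M_n)^d_{sa}:\sum_jY_j\otimes X_j\le I\ \forall Y\in\mathcal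 S\}$. *)

theory Defs
  imports
    "HOL-Analysis.Bounded_Linear_Function"
    "Jordan_Normal_Form.Schur_Decomposition"
begin

section \<open>Complex Hilbert spaces\<close>

text \<open>
  A complex Hilbert space is presented as an extension of the library's real inner product spaces,
  so that norm, topology and completeness are the library's. The complex inner product is linear in
  its first argument, and its real part is the underlying real inner product; in particular
  \<open>norm x = sqrt (Re (cinner x x))\<close>.
\<close>

class chilbert_space = real_inner + complete_space +
  fixes scaleC :: "complex \<Rightarrow> 'a \<Rightarrow> 'a" (infixr "*\<^sub>C" 75)
    and cinner :: "'a \<Rightarrow> 'a \<Rightarrow> complex"
  assumes scaleC_add_right: "c *\<^sub>C (x + y) = c *\<^sub>C x + c *\<^sub>C y"
    and scaleC_add_left: "(c + d) *\<^sub>C x = c *\<^sub>C x + d *\<^sub>C x"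
    and scaleC_scaleC: "c *\<^sub>C d *\<^sub>C x = (c * d) *\<^sub>C x"
    and scaleC_complex_of_real: "complex_of_real r *\<^sub>C x = r *\<^sub>R x"
    and cinner_commute: "cinner x y = cnj (cinner y x)"
    and cinner_add_left: "cinner (x + y) z = cinner x z + cinner y z"
    and cinner_scaleC_left: "cinner (c *\<^sub>C x) y = c * cinner x y"
    and Re_cinner: "Re (cinner x y) = inner x y"

instantiation complex :: chilbert_space
begin

definition scaleC_complex :: "complex \<Rightarrow> complex \<Rightarrow> complex"
  where "scaleC_complex c x = c * x"

definition cinner_complex :: "complex \<Rightarrow> complex \<Rightarrow> complex"
  where "cinner_complex x y = x * cnj y"

instance
  by standard
    (auto simp: scaleC_complex_def cinner_complex_def inner_complex_def algebra_simps scaleR_conv_of_real)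

end

lemma cinner_self: "cinner x x = complex_of_real ((norm x)\<^sup>2)"
proof (rule complex_eqI)
  show "Re (cinner x x) = Re (complex_of_real ((norm x)\<^sup>2))"
    by (simp add: Re_cinner power2_norm_eq_inner)
  have "Im (cinner x x) = - Im (cinner x x)"
    by (metis cinner_commute cnj.sel(2))
  then show "Im (cinner x x) = Im (complex_of_real ((norm x)\<^sup>2))"
    by simp
qed

lemma norm_scaleC: "norm (c *\<^sub>C x) = cmod c * norm x"
proof -
  have "cinner (c *\<^sub>C x) (c *\<^sub>C x) = c * cnj c * cinner x x"
    by (metis cinner_commute cinner_scaleC_left complex_cnj_mult mult.assoc)
  then have "complex_of_real ((norm (c *\<^sub>C x))\<^sup>2) = complex_of_real ((cmod c * norm x)\<^sup>2)"
    by (simp only: cinner_self complex_norm_square[symmetric] power_mult_distrib of_real_mult)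
  then have "(norm (c *\<^sub>C x))\<^sup>2 = (cmod c * norm x)\<^sup>2"
    using of_real_eq_iff by blast
  then show ?thesis
    by (rule power2_eq_imp_eq) simp_all
qed

lemma bounded_linear_scaleC: "bounded_linear (\<lambda>x. c *\<^sub>C (x :: 'h::chilbert_space))"
proof (rule bounded_linear_intro[where K = "cmod c"])
  fix x y :: 'h and r :: real
  show "c *\<^sub>C (x + y) = c *\<^sub>C x + c *\<^sub>C y"
    by (rule scaleC_add_right)
  show "c *\<^sub>C r *\<^sub>R x = r *\<^sub>R c *\<^sub>C x"
    by (simp add: scaleC_complex_of_real[symmetric] scaleC_scaleC mult.commute)
  show "norm (c *\<^sub>C x) \<le> norm x * cmod c"
    by (simp add: norm_scaleC mult.commute)
qed


section \<open>Bounded operators\<close>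

text \<open>
  The library type \<open>'h \<Rightarrow>\<^sub>L 'h\<close> consists of the bounded real-linear maps; \<open>bounded_ops\<close>, that is
  \<open>B(H)\<close>, is the subset of complex-linear ones. Its norm is the operator norm and its
  multiplication is \<open>(o\<^sub>L)\<close>.
\<close>

definition bounded_ops :: "('h::chilbert_space \<Rightarrow>\<^sub>L 'h) set"
  where "bounded_ops = {T :: 'h \<Rightarrow>\<^sub>L 'h. \<forall>c x. T (c *\<^sub>C x) = c *\<^sub>C T x}"

definition op_scale :: "complex \<Rightarrow> ('h::chilbert_space \<Rightarrow>\<^sub>L 'h) \<Rightarrow> 'h \<Rightarrow>\<^sub>L 'h"
  where "op_scale c T = Blinfun (\<lambda>x. c *\<^sub>C T x)"

lemma op_scale_apply [simp]: "blinfun_apply (op_scale c T) x = c *\<^sub>C T x"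
  unfolding op_scale_def
  using bounded_linear_compose[OF bounded_linear_scaleC blinfun.bounded_linear_right, of c T]
  by (simp add: bounded_linear_Blinfun_apply)

text \<open>Existence of the adjoint of an element of \<open>bounded_ops\<close> is the Riesz representation theorem.\<close>

definition op_adj :: "('h::chilbert_space \<Rightarrow>\<^sub>L 'h) \<Rightarrow> 'h \<Rightarrow>\<^sub>L 'h"
  where "op_adj T = (THE S :: 'h \<Rightarrow>\<^sub>L 'h. \<forall>x y. cinner (T x) y = cinner x (S y))"

lemma op_adj_eqI:
  assumes "\<And>x y. cinner (blinfun_apply T x) y = cinner x (blinfun_apply S y)"
  shows "op_adj T = S"
  unfolding op_adj_def
proof (rule the_equality)
  show "\<forall>x y. cinner (T x) y = cinner x (S y)"
    using assms by blast
next
  fix S' assume S': "\<forall>x y. cinner (T x) y = cinner x (blinfun_apply S' y)"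
  show "S' = S"
  proof (rule blinfun_eqI)
    fix y
    have "inner x (S' y) = inner x (S y)" for x
      using S' assms by (metis Re_cinner)
    then have "inner (S' y - S y) (S' y - S y) = 0"
      by (simp add: inner_diff_right)
    then show "S' y = S y"
      by simp
  qed
qed

definition unital_cstar_subalgebra :: "('h::chilbert_space \<Rightarrow>\<^sub>L 'h) set \<Rightarrow> bool"
  where "unital_cstar_subalgebra C \<longleftrightarrow>
    C \<subseteq> bounded_ops \<and> id_blinfun \<in> C \<and>
    (\<forall>S\<in>C. \<forall>T\<in>C. S + T \<in> C) \<and>
    (\<forall>c. \<forall>T\<in>C. op_scale c T \<in> C) \<and>
    (\<forall>S\<in>C. \<forall>T\<in>C. S o\<^sub>L T \<in> C) \<and>
    (\<forall>T\<in>C. op_adj T \<in> C) \<and>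
    closed C"

definition cstar_generated :: "('d \<Rightarrow> 'h::chilbert_space \<Rightarrow>\<^sub>L 'h) \<Rightarrow> ('h \<Rightarrow>\<^sub>L 'h) set"
  where "cstar_generated A = \<Inter> {C. unital_cstar_subalgebra C \<and> range A \<subseteq> C}"


section \<open>Complex matrices\<close>

text \<open>
  The order on \<open>complex\<close> is the one of \<open>HOL-Library.Complex_Order\<close>: \<open>0 \<le> z\<close> says that \<open>z\<close> is real
  and nonnegative.
\<close>

definition mat_pos :: "nat \<Rightarrow> complex mat \<Rightarrow> bool"
  where "mat_pos n P \<longleftrightarrow> P \<in> carrier_mat n n \<and> (\<forall>v \<in> carrier_vec n. 0 \<le> (P *\<^sub>v v) \<bullet>c v)"

definition mat_le :: "nat \<Rightarrow> complex mat \<Rightarrow> complex mat \<Rightarrow> bool"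
  where "mat_le n P Q \<longleftrightarrow> P \<in> carrier_mat n n \<and> Q \<in> carrier_mat n n \<and> mat_pos n (Q - P)"

definition mat_Re :: "complex mat \<Rightarrow> complex mat"
  where "mat_Re P = (1 / 2) \<cdot>\<^sub>m (P + mat_adjoint P)"

text \<open>\<open>d\<close>-tuples are functions on a finite type with \<open>d\<close> elements.\<close>

definition mat_tuples :: "nat \<Rightarrow> ('d::finite \<Rightarrow> complex mat) set"
  where "mat_tuples n = {X. \<forall>j. X j \<in> carrier_mat n n}"

definition sa_mat_tuples :: "nat \<Rightarrow> ('d::finite \<Rightarrow> complex mat) set"
  where "sa_mat_tuples n = {X \<in> mat_tuples n. \<forall>j. mat_adjoint (X j) = X j}"

text \<open>
  The sum over \<open>j\<close> of the Kronecker products of the \<open>m\<close>-by-\<open>m\<close> matrices \<open>Y j\<close> with the \<open>n\<close>-by-\<open>n\<close>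
  matrices \<open>X j\<close>; the pair of indices \<open>(a, i)\<close> is encoded as \<open>a * n + i\<close>.
\<close>

definition kron_sum ::
    "nat \<Rightarrow> nat \<Rightarrow> ('d::finite \<Rightarrow> complex mat) \<Rightarrow> ('d \<Rightarrow> complex mat) \<Rightarrow> complex mat"
  where "kron_sum m n Y X = mat (m * n) (m * n)
    (\<lambda>(k, l). \<Sum>j\<in>UNIV. Y j $$ (k div n, l div n) * X j $$ (k mod n, l mod n))"


section \<open>Matrices of operators\<close>

text \<open>
  An \<open>n\<close>-by-\<open>n\<close> matrix over \<open>bounded_ops\<close> is an operator on the Hilbert space \<open>H \<otimes> \<complex>\<^sup>n = H\<^sup>n\<close>, whose
  elements are given by their first \<open>n\<close> coordinates \<open>x 0, \<dots>, x (n - 1)\<close>.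
\<close>

definition op_mat_pos :: "nat \<Rightarrow> ('h::chilbert_space \<Rightarrow>\<^sub>L 'h) mat \<Rightarrow> bool"
  where "op_mat_pos n M \<longleftrightarrow> M \<in> carrier_mat n n \<and>
    (\<forall>x :: nat \<Rightarrow> 'h. 0 \<le> (\<Sum>i<n. cinner (\<Sum>j<n. (M $$ (i, j)) (x j)) (x i)))"

definition op_mat_one :: "nat \<Rightarrow> ('h::chilbert_space \<Rightarrow>\<^sub>L 'h) mat"
  where "op_mat_one n = mat n n (\<lambda>(i, j). if i = j then id_blinfun else 0)"

definition op_mat_adj :: "('h::chilbert_space \<Rightarrow>\<^sub>L 'h) mat \<Rightarrow> ('h \<Rightarrow>\<^sub>L 'h) mat"
  where "op_mat_adj M = mat (dim_col M) (dim_row M) (\<lambda>(i, j). op_adj (M $$ (j, i)))"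

definition op_mat_Re :: "('h::chilbert_space \<Rightarrow>\<^sub>L 'h) mat \<Rightarrow> ('h \<Rightarrow>\<^sub>L 'h) mat"
  where "op_mat_Re M = map_mat (\<lambda>T. (1 / 2) *\<^sub>R T) (M + op_mat_adj M)"

text \<open>
  The sum over \<open>j\<close> of \<open>A j \<otimes> X j\<close>: under \<open>H \<otimes> \<complex>\<^sup>n = H\<^sup>n\<close>, the \<open>(i, k)\<close> entry of \<open>T \<otimes> X\<close> is
  \<open>X\<^bsub>ik\<^esub> T\<close>.
\<close>

definition op_tensor_sum ::
    "nat \<Rightarrow> ('d::finite \<Rightarrow> 'h::chilbert_space \<Rightarrow>\<^sub>L 'h) \<Rightarrow> ('d \<Rightarrow> complex mat) \<Rightarrow> ('h \<Rightarrow>\<^sub>L 'h) mat"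
  where "op_tensor_sum n A X =
    mat n n (\<lambda>(i, k). \<Sum>j\<in>UNIV. op_scale (X j $$ (i, k)) (A j))"


section \<open>Matrix ranges\<close>

text \<open>
  The amplification of \<open>\<phi>\<close> applied to an \<open>m\<close>-by-\<open>m\<close> matrix of operators, where \<open>\<phi>\<close> takes values in
  the \<open>n\<close>-by-\<open>n\<close> matrices and \<open>M\<^sub>m(M\<^sub>n)\<close> is identified with \<open>M\<^bsub>mn\<^esub>\<close> by erasing the block structure.
\<close>

definition amplify ::
    "nat \<Rightarrow> nat \<Rightarrow> (('h::chilbert_space \<Rightarrow>\<^sub>L 'h) \<Rightarrow> complex mat) \<Rightarrow> ('h \<Rightarrow>\<^sub>L 'h) mat \<Rightarrow> complex mat"
  where "amplify m n \<phi> M = mat (m * n) (m * n)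
    (\<lambda>(k, l). \<phi> (M $$ (k div n, l div n)) $$ (k mod n, l mod n))"

text \<open>
  Unital completely positive maps from \<open>C\<close> to the \<open>n\<close>-by-\<open>n\<close> matrices; the values of \<open>\<phi>\<close> outside
  \<open>C\<close> are irrelevant.
\<close>

definition ucp_map ::
    "('h::chilbert_space \<Rightarrow>\<^sub>L 'h) set \<Rightarrow> nat \<Rightarrow> (('h \<Rightarrow>\<^sub>L 'h) \<Rightarrow> complex mat) \<Rightarrow> bool"
  where "ucp_map C n \<phi> \<longleftrightarrow>
    (\<forall>T\<in>C. \<phi> T \<in> carrier_mat n n) \<and>
    (\<forall>S\<in>C. \<forall>T\<in>C. \<phi> (S + T) = \<phi> S + \<phi> T) \<and>
    (\<forall>c. \<forall>T\<in>C. \<phi> (op_scale c T) = c \<cdot>\<^sub>m \<phi> T) \<and>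
    \<phi> id_blinfun = 1\<^sub>m n \<and>
    (\<forall>m>0. \<forall>M \<in> carrier_mat m m.
      elements_mat M \<subseteq> C \<longrightarrow> op_mat_pos m M \<longrightarrow> mat_pos (m * n) (amplify m n \<phi> M))"

definition matrix_range_level ::
    "nat \<Rightarrow> ('d::finite \<Rightarrow> 'h::chilbert_space \<Rightarrow>\<^sub>L 'h) \<Rightarrow> ('d \<Rightarrow> complex mat) set"
  where "matrix_range_level n A = {\<lambda>j. \<phi> (A j) | \<phi>. ucp_map (cstar_generated A) n \<phi>}"

definition matrix_range ::
    "('d::finite \<Rightarrow> 'h::chilbert_space \<Rightarrow>\<^sub>L 'h) \<Rightarrow> ('d \<Rightarrow> complex mat) set"
  where "matrix_range A = (\<Union>n\<in>{1..}. matrix_range_level n A)"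


section \<open>Free spectrahedra and polar duals\<close>

definition free_spectrahedron ::
    "('d::finite \<Rightarrow> 'h::chilbert_space \<Rightarrow>\<^sub>L 'h) \<Rightarrow> ('d \<Rightarrow> complex mat) set"
  where "free_spectrahedron A =
    (\<Union>n\<in>{1..}. {X \<in> mat_tuples n. op_mat_pos n (op_mat_Re (op_mat_one n - op_tensor_sum n A X))})"

definition sa_free_spectrahedron ::
    "('d::finite \<Rightarrow> 'h::chilbert_space \<Rightarrow>\<^sub>L 'h) \<Rightarrow> ('d \<Rightarrow> complex mat) set"
  where "sa_free_spectrahedron A =
    (\<Union>n\<in>{1..}. {X \<in> sa_mat_tuples n. op_mat_pos n (op_mat_one n - op_tensor_sum n A X)})"

definition polar_dual :: "('d::finite \<Rightarrow> complex mat) set \<Rightarrow> ('d \<Rightarrow> complex mat) set"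
  where "polar_dual \<S> =
    (\<Union>n\<in>{1..}. {X \<in> mat_tuples n.
      \<forall>m\<ge>1. \<forall>Y \<in> \<S> \<inter> mat_tuples m. mat_le (m * n) (mat_Re (kron_sum m n Y X)) (1\<^sub>m (m * n))})"

definition sa_polar_dual :: "('d::finite \<Rightarrow> complex mat) set \<Rightarrow> ('d \<Rightarrow> complex mat) set"
  where "sa_polar_dual \<S> =
    (\<Union>n\<in>{1..}. {X \<in> sa_mat_tuples n.
      \<forall>m\<ge>1. \<forall>Y \<in> \<S> \<inter> sa_mat_tuples m. mat_le (m * n) (kron_sum m n Y X) (1\<^sub>m (m * n))})"

end

theory Submission
  imports Defs "HOL-Analysis.Function_Topology"
begin

text \<open>
  A unital completely positive \<open>\<phi>\<close> carries the inequality \<open>Re (I - \<Sum>\<^sub>j A\<^sub>j \<otimes> Y\<^sub>j) \<ge> 0\<close> to its image,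
  which is the polar inequality for \<open>X = \<phi>(A)\<close>.

  Conversely, the completely positive maps form a closed cone whose sections of bounded trace are
  compact. If no \<open>\<phi>\<close> in it has \<open>\<phi>(I) = I\<close> and \<open>\<phi>(A) = X\<close>, minimizing the squared distance of
  \<open>(\<phi>(I), \<phi>(A))\<close> to \<open>(I, X)\<close> over the cone yields scalar matrices \<open>P\<close> and \<open>L\<^sub>j\<close> such that
  \<open>Re (P \<otimes> I + \<Sum>\<^sub>j L\<^sub>j \<otimes> A\<^sub>j) \<ge> 0\<close>, while the pairing of \<open>(P, L)\<close> with \<open>(I, X)\<close> is negative. As
  \<open>0 \<in> W(A)\<close>, the matrix \<open>P\<close> is positive, and after a small perturbation \<open>S\<^sup>* P S = I\<close> for an
  invertible \<open>S\<close>. Then \<open>Y\<^sub>j = - S\<^sup>* L\<^sub>j S\<close> belongs to the free spectrahedron, and the polar inequality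
  for \<open>X\<close> and \<open>Y\<close>, evaluated at the vector with coordinates \<open>S\<^sup>-\<^sup>1\<close>, says that the pairing is nonnegative.
  In the self-adjoint case \<open>L\<^sub>j\<close> may be replaced by its self-adjoint part.
\<close>

section \<open>Adjoints and the C*-algebra generated by a tuple\<close>

text \<open>Minimize \<open>g x = (norm x)\<^sup>2 - 2 * f x\<close>. The linear terms cancel in the
  parallelogram identity for \<open>g\<close>, so a minimizing sequence is Cauchy; at its limit
  \<open>y\<close> the first variation of \<open>g\<close> vanishes, which says that
  \<open>f\<close> is the inner product with \<open>y\<close>.\<close>

lemma riesz_representation:
  fixes f :: "'h::{real_inner, complete_space} \<Rightarrow> real"
  assumes f: "bounded_linear f"
  obtains y where "\<And>x. f x = inner x y"
proof -
  interpret f: bounded_linear f by (rule f)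
  define g where "g x = (norm x)\<^sup>2 - 2 * f x" for x
  obtain K where K: "\<And>x. norm (f x) \<le> norm x * K" "K \<ge> 0"
    using f.nonneg_bounded by blast
  have g_lower: "- (K\<^sup>2) \<le> g x" for x
  proof -
    have "0 \<le> (norm x - K)\<^sup>2"
      by simp
    then have "2 * (norm x * K) \<le> (norm x)\<^sup>2 + K\<^sup>2"
      by (simp add: power2_diff)
    moreover have "f x \<le> norm x * K"
      using K(1)[of x] by simp
    ultimately show ?thesis
      unfolding g_def by linarith
  qed
  define m where "m = Inf (range g)"
  have bdd: "bdd_below (range g)"
    using g_lower by (auto simp: bdd_below_def)
  have m_le: "m \<le> g x" for x
    unfolding m_def by (rule cInf_lower) (use bdd in auto)
  have "\<exists>x. g x < m + inverse (real (Suc n))" for n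
    using cInf_lessD[of "range g" "m + inverse (real (Suc n))"] by (auto simp: m_def)
  then obtain u where u: "\<And>n. g (u n) < m + inverse (real (Suc n))"
    by metis
  have parallelogram: "(norm (x - y))\<^sup>2 = 2 * g x + 2 * g y - 4 * g ((1/2) *\<^sub>R (x + y))" for x y
    unfolding g_def
    by (simp add: f.scaleR f.add power2_norm_eq_inner inner_add_left inner_add_right
        inner_diff_left inner_diff_right inner_commute algebra_simps power_divide)
  have "Cauchy u"
  proof (rule metric_CauchyI)
    fix e :: real assume "0 < e"
    then obtain N where N: "inverse (real (Suc N)) < e\<^sup>2 / 4"
      using reals_Archimedean[of "e\<^sup>2 / 4"] by auto
    have "dist (u n) (u k) < e" if "N \<le> n" "N \<le> k" for n k
    proof -
      have "inverse (real (Suc n)) \<le> inverse (real (Suc N))"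
        "inverse (real (Suc k)) \<le> inverse (real (Suc N))"
        using that by (auto intro: le_imp_inverse_le)
      then have "(norm (u n - u k))\<^sup>2 < e\<^sup>2"
        using parallelogram[of "u n" "u k"] u[of n] u[of k] m_le[of "(1/2) *\<^sub>R (u n + u k)"] N
        by linarith
      then show ?thesis
        using \<open>0 < e\<close> by (simp add: dist_norm power_less_imp_less_base)
    qed
    then show "\<exists>M. \<forall>m\<ge>M. \<forall>n\<ge>M. dist (u m) (u n) < e"
      by blast
  qed
  then obtain y where y: "u \<longlonglongrightarrow> y"
    using Cauchy_convergent convergent_def by blast
  have "(\<lambda>n. g (u n)) \<longlonglongrightarrow> g y"
    unfolding g_def by (intro tendsto_intros f.tendsto y)
  moreover have "(\<lambda>n. m + inverse (real (Suc n))) \<longlonglongrightarrow> m + 0"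
    by (intro tendsto_intros LIMSEQ_inverse_real_of_nat)
  ultimately have "g y \<le> m + 0"
    by (rule LIMSEQ_le) (use u in \<open>auto intro: less_imp_le\<close>)
  then have min: "g y \<le> g x" for x
    using m_le[of x] by simp
  have "f x = inner x y" for x
  proof -
    define c where "c = inner x y - f x"
    have var: "0 \<le> 2 * t * c + t * t * (norm x)\<^sup>2" for t
      using min[of "y + t *\<^sub>R x"] unfolding g_def c_def
      by (simp add: f.scaleR f.add power2_norm_eq_inner inner_add_left inner_add_right
          inner_commute algebra_simps)
    \<comment> \<open>The best step for the quadratic in \<open>t\<close> would be
      \<open>- c / (norm x)\<^sup>2\<close>. Adding 1 to the denominator avoids division by zero at
      \<open>x = 0\<close> and still forces \<open>c = 0\<close>.\<close>
    define s where "s = 1 + (norm x)\<^sup>2"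
    have s: "0 < s" "(norm x)\<^sup>2 < s"
      by (simp_all add: s_def add_pos_nonneg)
    have "0 \<le> 2 * (- c / s) * c + (- c / s) * (- c / s) * (norm x)\<^sup>2"
      by (rule var)
    then have "0 \<le> (2 * (- c / s) * c + (- c / s) * (- c / s) * (norm x)\<^sup>2) * s\<^sup>2"
      by simp
    also have "\<dots> = - (c\<^sup>2 * (2 * s - (norm x)\<^sup>2))"
      using s(1) by (simp add: field_simps power2_eq_square)
    finally have "c\<^sup>2 * (2 * s - (norm x)\<^sup>2) \<le> 0"
      by simp
    then have "c = 0"
      using s by (simp add: mult_le_0_iff not_le)
    then show ?thesis
      by (simp add: c_def)
  qed
  then show thesis
    by (rule that)
qed

section \<open>Complex inner products and existence of adjoints\<close>

lemma cinner_add_right: "cinner x (y + z) = cinner x y + cinner x (z :: 'h::chilbert_space)"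
  by (metis cinner_add_left cinner_commute complex_cnj_add)

lemma cinner_scaleC_right: "cinner x (c *\<^sub>C y) = cnj c * cinner x (y :: 'h::chilbert_space)"
  by (metis cinner_commute cinner_scaleC_left complex_cnj_mult)

lemma cinner_zero_left [simp]: "cinner 0 (x :: 'h::chilbert_space) = 0"
  using cinner_add_left[of 0 0 x] by simp

lemma cinner_zero_right [simp]: "cinner (x :: 'h::chilbert_space) 0 = 0"
  using cinner_add_right[of x 0 0] by simp

lemma cinner_scaleR_left: "cinner (r *\<^sub>R x) y = complex_of_real r * cinner x (y :: 'h::chilbert_space)"
  by (metis cinner_scaleC_left scaleC_complex_of_real)

lemma cinner_sum_left: "cinner (\<Sum>i\<in>I. f i) (y :: 'h::chilbert_space) = (\<Sum>i\<in>I. cinner (f i) y)"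
  by (induction I rule: infinite_finite_induct) (auto simp: cinner_add_left)

lemma cinner_sum_right: "cinner x (\<Sum>i\<in>I. f i :: 'h::chilbert_space) = (\<Sum>i\<in>I. cinner x (f i))"
  by (induction I rule: infinite_finite_induct) (auto simp: cinner_add_right)

text \<open>Rotating \<open>x\<close> by the phase \<open>c\<close> makes the inner product real and
  nonnegative, so the real Cauchy-Schwarz inequality applies.\<close>

lemma cinner_bound: "cmod (cinner x y) \<le> norm x * norm (y :: 'h::chilbert_space)"
proof (cases "cinner x y = 0")
  case False
  define c where "c = cnj (cinner x y) / cmod (cinner x y)"
  have "cmod c = 1"
    using False by (simp add: c_def norm_divide)
  have "c * cinner x y = complex_of_real (cmod (cinner x y))"
    using False unfolding c_def
    by (metis complex_norm_square mult.commute nonzero_mult_div_cancel_left norm_eq_zero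
        of_real_eq_0_iff of_real_power power2_eq_square times_divide_eq_left)
  then have "cmod (cinner x y) = inner (c *\<^sub>C x) y"
    by (metis Re_complex_of_real Re_cinner cinner_scaleC_left)
  also have "\<dots> \<le> norm (c *\<^sub>C x) * norm y"
    by (rule norm_cauchy_schwarz)
  finally show ?thesis
    by (simp add: norm_scaleC \<open>cmod c = 1\<close>)
qed simp

lemma cinner_eqI:
  assumes "\<And>x. cinner x y = cinner x (z :: 'h::chilbert_space)"
  shows "y = z"
proof -
  have "inner (y - z) y = inner (y - z) z"
    using assms by (metis Re_cinner)
  then have "inner (y - z) (y - z) = 0"
    by (simp add: inner_diff_right)
  then show ?thesis
    by simp
qed

lemma bounded_ops_scaleC:
  "T \<in> bounded_ops \<Longrightarrow> blinfun_apply T (c *\<^sub>C x) = c *\<^sub>C T x"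
  by (simp add: bounded_ops_def)

text \<open>The Riesz representation for the real inner product produces \<open>S\<close> and
  settles the real parts. The imaginary parts follow by replacing \<open>x\<close> with
  \<open>(-\<i>) *\<^sub>C x\<close>, and this is where complex linearity of \<open>T\<close>
  enters.\<close>

lemma cinner_op_adj:
  fixes T :: "'h::chilbert_space \<Rightarrow>\<^sub>L 'h"
  assumes T: "T \<in> bounded_ops"
  shows "cinner (T x) y = cinner x (op_adj T y)"
proof -
  have "\<exists>z. \<forall>x. inner (T x) y = inner x z" for y
  proof -
    have "bounded_linear (\<lambda>x. inner (T x) y)"
      by (intro bounded_linear_intros)
    from riesz_representation[OF this] show ?thesis
      by metis
  qed
  then obtain S where S: "\<And>x y. inner (T x) y = inner x (S y)"
    by metis
  have eqI: "u = v" if "\<And>x. inner x u = inner x v" for u v :: 'h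
  proof -
    have "inner (u - v) (u - v) = 0"
      using that[of "u - v"] by (simp add: inner_diff_right)
    then show ?thesis
      by simp
  qed
  have "bounded_linear S"
  proof (rule bounded_linear_intro[where K = "norm T"])
    show "S (u + v) = S u + S v" for u v
      by (rule eqI) (simp add: S[symmetric] inner_add_right)
    show "S (r *\<^sub>R u) = r *\<^sub>R S u" for r u
      by (rule eqI) (simp add: S[symmetric])
    show "norm (S u) \<le> norm u * norm T" for u
    proof -
      have "norm (S u) * norm (S u) = inner (T (S u)) u"
        by (metis S dot_square_norm power2_eq_square)
      also have "\<dots> \<le> norm (T (S u)) * norm u"
        by (rule norm_cauchy_schwarz)
      also have "\<dots> \<le> norm T * norm (S u) * norm u"
        by (intro mult_right_mono norm_blinfun) simp
      finally have "norm (S u) * norm (S u) \<le> norm (S u) * (norm u * norm T)"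
        by (simp add: mult_ac)
      then show ?thesis
        by (cases "norm (S u) = 0") (auto dest: mult_left_le_imp_le)
    qed
  qed
  then have S_blinfun: "blinfun_apply (Blinfun S) = S"
    by (rule bounded_linear_Blinfun_apply)
  have adj: "cinner (T x) y = cinner x (S y)" for x y
  proof (rule complex_eqI)
    show "Re (cinner (T x) y) = Re (cinner x (S y))"
      by (simp add: Re_cinner S)
    have Im: "Im (cinner u v) = inner ((-\<i>) *\<^sub>C u) v" for u v :: 'h
      by (simp add: Re_cinner[symmetric] cinner_scaleC_left)
    show "Im (cinner (T x) y) = Im (cinner x (S y))"
      by (simp add: Im bounded_ops_scaleC[OF T, symmetric] S)
  qed
  then have "op_adj T = Blinfun S"
    by (intro op_adj_eqI) (simp add: S_blinfun)
  then show ?thesis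
    by (simp add: S_blinfun adj)
qed

lemma cinner_op_adj_left:
  "T \<in> bounded_ops \<Longrightarrow> cinner (op_adj T x) y = cinner x (blinfun_apply T y)"
  by (metis cinner_commute cinner_op_adj)

lemma op_adj_bounded_ops:
  assumes T: "T \<in> bounded_ops"
  shows "op_adj T \<in> bounded_ops"
  unfolding bounded_ops_def
proof (intro CollectI allI)
  fix c x
  show "op_adj T (c *\<^sub>C x) = c *\<^sub>C op_adj T x"
    by (rule cinner_eqI) (simp add: cinner_op_adj[OF T, symmetric] cinner_scaleC_right)
qed

text \<open>Makes the family intersected in \<open>cstar_generated A\<close> nonempty, so that the
  intersection lies in \<open>bounded_ops\<close>.\<close>

lemma unital_cstar_subalgebra_bounded_ops:
  "unital_cstar_subalgebra (bounded_ops :: ('h::chilbert_space \<Rightarrow>\<^sub>L 'h) set)"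
proof -
  have "closed (bounded_ops :: ('h \<Rightarrow>\<^sub>L 'h) set)"
    unfolding bounded_ops_def
    by (intro closed_Collect_all closed_Collect_eq continuous_intros
        bounded_linear.continuous_on[OF bounded_linear_scaleC])
  then show ?thesis
    unfolding unital_cstar_subalgebra_def
    by (auto simp: op_adj_bounded_ops bounded_ops_def[where 'h='h] blinfun.add_left scaleC_add_right
        scaleC_scaleC mult.commute op_adj_bounded_ops[unfolded bounded_ops_def, simplified])
qed

lemma unital_cstar_subalgebra_cstar_generated:
  assumes "\<forall>j. A j \<in> bounded_ops"
  shows "unital_cstar_subalgebra (cstar_generated A)" and "A j \<in> cstar_generated A"
proof -
  have "cstar_generated A \<subseteq> bounded_ops"
    unfolding cstar_generated_def
    using assms unital_cstar_subalgebra_bounded_ops by blast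
  moreover have "closed (cstar_generated A)"
    unfolding cstar_generated_def
    by (rule closed_Inter) (auto simp: unital_cstar_subalgebra_def)
  ultimately show "unital_cstar_subalgebra (cstar_generated A)"
    unfolding unital_cstar_subalgebra_def
    by (auto simp: cstar_generated_def unital_cstar_subalgebra_def)
  show "A j \<in> cstar_generated A"
    by (auto simp: cstar_generated_def)
qed

section \<open>Positivity in terms of forms\<close>

definition op_form :: "nat \<Rightarrow> (nat \<Rightarrow> nat \<Rightarrow> 'h::chilbert_space \<Rightarrow>\<^sub>L 'h) \<Rightarrow> (nat \<Rightarrow> 'h) \<Rightarrow> complex"
  where "op_form m N x = (\<Sum>i<m. \<Sum>k<m. cinner (N i k (x k)) (x i))"

definition mat_form :: "nat \<Rightarrow> (nat \<Rightarrow> nat \<Rightarrow> complex) \<Rightarrow> (nat \<Rightarrow> complex) \<Rightarrow> complex"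
  where "mat_form n f v = (\<Sum>k<n. \<Sum>l<n. f k l * v l * cnj (v k))"

text \<open>The quadratic form of an \<open>m * n\<close> square matrix read as an array of
  \<open>n\<close> by \<open>n\<close> blocks: \<open>F i k s t\<close> is entry
  \<open>(s, t)\<close> of block \<open>(i, k)\<close>. The doubly indexed vector keeps
  \<open>div\<close> and \<open>mod\<close> out of the later computations.\<close>

definition block_form ::
    "nat \<Rightarrow> nat \<Rightarrow> (nat \<Rightarrow> nat \<Rightarrow> nat \<Rightarrow> nat \<Rightarrow> complex) \<Rightarrow> (nat \<Rightarrow> nat \<Rightarrow> complex) \<Rightarrow> complex"
  where "block_form m n F v =
    (\<Sum>i<m. \<Sum>k<m. \<Sum>s<n. \<Sum>t<n. F i k s t * v k t * cnj (v i s))"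

lemma complex_nonneg_iff: "0 \<le> z \<longleftrightarrow> 0 \<le> Re z \<and> Im z = 0" for z :: complex
  by (auto simp: less_eq_complex_def)

lemma op_mat_pos_iff:
  assumes "M \<in> carrier_mat m m"
  shows "op_mat_pos m M \<longleftrightarrow> (\<forall>x. 0 \<le> op_form m (\<lambda>i k. M $$ (i, k)) x)"
  using assms by (simp add: op_mat_pos_def op_form_def cinner_sum_left)

lemma op_mat_Re_carrier: "M \<in> carrier_mat m m \<Longrightarrow> op_mat_Re M \<in> carrier_mat m m"
  by (auto simp: op_mat_Re_def op_mat_adj_def)

text \<open>The adjoint summand contributes the complex conjugate of the form, after an exchange of
  the two summation indices.\<close>

lemma op_form_op_mat_Re:
  assumes M: "M \<in> carrier_mat m m" and B: "\<And>i k. i < m \<Longrightarrow> k < m \<Longrightarrow> M $$ (i, k) \<in> bounded_ops"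
  shows "op_form m (\<lambda>i k. op_mat_Re M $$ (i, k)) x =
    complex_of_real (Re (op_form m (\<lambda>i k. M $$ (i, k)) x))"
proof -
  let ?f = "op_form m (\<lambda>i k. M $$ (i, k)) x"
  have entry: "op_mat_Re M $$ (i, k) = (1/2) *\<^sub>R (M $$ (i, k) + op_adj (M $$ (k, i)))"
    if "i < m" "k < m" for i k
    using that M by (auto simp: op_mat_Re_def op_mat_adj_def)
  have "cinner (blinfun_apply (op_mat_Re M $$ (i, k)) (x k)) (x i) =
      1/2 * cinner (blinfun_apply (M $$ (i, k)) (x k)) (x i) +
      1/2 * cnj (cinner (blinfun_apply (M $$ (k, i)) (x i)) (x k))"
    if "i < m" "k < m" for i k
    using that B[of k i] cinner_commute[of "x k" "blinfun_apply (M $$ (k, i)) (x i)"]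
    by (simp add: entry blinfun.add_left blinfun.scaleR_left cinner_scaleR_left cinner_add_left
        cinner_op_adj_left distrib_left)
  then have "op_form m (\<lambda>i k. op_mat_Re M $$ (i, k)) x =
      (\<Sum>i<m. \<Sum>k<m. 1/2 * cinner (blinfun_apply (M $$ (i, k)) (x k)) (x i)) +
      (\<Sum>i<m. \<Sum>k<m. 1/2 * cnj (cinner (blinfun_apply (M $$ (k, i)) (x i)) (x k)))"
    by (simp add: op_form_def sum.distrib)
  also have "(\<Sum>i<m. \<Sum>k<m. 1/2 * cnj (cinner (blinfun_apply (M $$ (k, i)) (x i)) (x k))) = 1/2 * cnj ?f"
    unfolding op_form_def by (subst sum.swap) (simp add: sum_distrib_left)
  also have "(\<Sum>i<m. \<Sum>k<m. 1/2 * cinner (blinfun_apply (M $$ (i, k)) (x k)) (x i)) = 1/2 * ?f"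
    unfolding op_form_def by (simp add: sum_distrib_left)
  finally show ?thesis
    by (simp add: complex_eq_iff)
qed

lemma op_mat_pos_Re_iff:
  assumes "M \<in> carrier_mat m m" and "\<And>i k. i < m \<Longrightarrow> k < m \<Longrightarrow> M $$ (i, k) \<in> bounded_ops"
  shows "op_mat_pos m (op_mat_Re M) \<longleftrightarrow> (\<forall>x. 0 \<le> Re (op_form m (\<lambda>i k. M $$ (i, k)) x))"
  by (simp add: op_mat_pos_iff[OF op_mat_Re_carrier[OF assms(1)]] op_form_op_mat_Re[OF assms]
      complex_nonneg_iff)

section \<open>Scalar matrices and their block structure\<close>

lemma mat_pos_iff:
  assumes P: "P \<in> carrier_mat n n"
  shows "mat_pos n P \<longleftrightarrow> (\<forall>v. 0 \<le> mat_form n (\<lambda>k l. P $$ (k, l)) v)"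
proof -
  have form: "(P *\<^sub>v vec n v) \<bullet>c vec n v = mat_form n (\<lambda>k l. P $$ (k, l)) v" for v
    using P unfolding mat_form_def
    by (auto simp: scalar_prod_def sum_distrib_right lessThan_atLeast0 intro!: sum.cong)
  have carrier: "(\<forall>v\<in>carrier_vec n. R v) \<longleftrightarrow> (\<forall>v. R (vec n v))" for R :: "complex vec \<Rightarrow> bool"
    by (metis carrier_vecD eq_vecI dim_vec index_vec vec_carrier)
  show ?thesis
    using P by (simp add: mat_pos_def carrier form)
qed

text \<open>The vector is \<open>x\<close> times unit vector \<open>a\<close> plus \<open>y\<close>
  times unit vector \<open>b\<close>. As a sum of two indicator terms it also covers
  \<open>a = b\<close>.\<close>

lemma mat_form_two_units:
  assumes "a < n" "b < n"
  shows "mat_form n f (\<lambda>k. x * of_bool (k = a) + y * of_bool (k = b)) =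
    (f a a * x + f a b * y) * cnj x + (f b a * x + f b b * y) * cnj y"
proof -
  have unit: "(\<Sum>l<n. g l * of_bool (l = c)) = g c" if "c < n" for g :: "nat \<Rightarrow> complex" and c
    using that by (simp add: of_bool_def if_distrib[of "times _"] cong: if_cong)
  let ?v = "\<lambda>k. x * of_bool (k = a) + y * of_bool (k = b)"
  have row: "(\<Sum>l<n. f k l * ?v l * cnj (?v k)) = (f k a * x + f k b * y) * cnj (?v k)" for k
  proof -
    have "(\<Sum>l<n. f k l * ?v l) = (\<Sum>l<n. (f k l * x) * of_bool (l = a)) +
        (\<Sum>l<n. (f k l * y) * of_bool (l = b))"
      by (simp add: sum.distrib distrib_left mult.assoc)
    also have "\<dots> = f k a * x + f k b * y"
      using assms by (simp only: unit)
    finally show ?thesis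
      by (simp add: sum_distrib_right[symmetric])
  qed
  have "mat_form n f ?v = (\<Sum>k<n. ((f k a * x + f k b * y) * cnj x) * of_bool (k = a)) +
      (\<Sum>k<n. ((f k a * x + f k b * y) * cnj y) * of_bool (k = b))"
    unfolding mat_form_def row sum.distrib[symmetric]
    by (intro sum.cong refl) (simp add: distrib_left mult.assoc of_bool_def)
  also have "\<dots> = (f a a * x + f a b * y) * cnj x + (f b a * x + f b b * y) * cnj y"
    using assms by (simp only: unit)
  finally show ?thesis .
qed

text \<open>Polarization: the form is real at the two unit vectors, at their sum, and at the first
  plus \<i> times the second.\<close>

lemma mat_form_hermitian:
  assumes pos: "\<And>v. 0 \<le> mat_form n f v" and "a < n" "b < n"
  shows "f a b = cnj (f b a)"
proof -
  have real: "Im ((f a a * x + f a b * y) * cnj x + (f b a * x + f b b * y) * cnj y) = 0" for x y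
    using pos[of "\<lambda>k. x * of_bool (k = a) + y * of_bool (k = b)"]
    by (simp only: mat_form_two_units[OF assms(2,3)] complex_nonneg_iff)
  show ?thesis
    using real[of 1 0] real[of 0 1] real[of 1 1] real[of 1 \<i>] by (simp add: complex_eq_iff)
qed

lemma mat_adjoint_index:
  assumes "M \<in> carrier_mat n n" "i < n" "k < n"
  shows "mat_adjoint M $$ (i, k) = cnj (M $$ (k, i))"
  using assms by (simp add: mat_adjoint_def mat_of_rows_index)

lemma mat_adjoint_carrier: "M \<in> carrier_mat n n \<Longrightarrow> mat_adjoint M \<in> carrier_mat n n"
  by (simp add: mat_adjoint_def mat_of_rows_def)

lemma mat_adjoint_eq_iff:
  assumes M: "M \<in> carrier_mat n n" and L: "L \<in> carrier_mat n n"
  shows "mat_adjoint M = L \<longleftrightarrow> (\<forall>i<n. \<forall>k<n. cnj (M $$ (k, i)) = L $$ (i, k))"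
proof
  assume "mat_adjoint M = L"
  then show "\<forall>i<n. \<forall>k<n. cnj (M $$ (k, i)) = L $$ (i, k)"
    using mat_adjoint_index[OF M] by metis
next
  assume "\<forall>i<n. \<forall>k<n. cnj (M $$ (k, i)) = L $$ (i, k)"
  then show "mat_adjoint M = L"
    using L mat_adjoint_carrier[OF M] by (intro eq_matI) (simp_all add: mat_adjoint_index[OF M])
qed

lemma mat_le_Re_one_iff:
  assumes K: "K \<in> carrier_mat n n"
  shows "mat_le n (mat_Re K) (1\<^sub>m n) \<longleftrightarrow>
    (\<forall>v. 0 \<le> Re (mat_form n (\<lambda>k l. (if k = l then 1 else 0) - K $$ (k, l)) v))"
proof -
  let ?g = "\<lambda>k l. (if k = l then 1 else 0) - K $$ (k, l)"
  have Re: "mat_Re K \<in> carrier_mat n n"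
    using K mat_adjoint_carrier[OF K] by (simp add: mat_Re_def)
  have "mat_form n (\<lambda>k l. (1\<^sub>m n - mat_Re K) $$ (k, l)) v =
      complex_of_real (Re (mat_form n ?g v))" for v
  proof -
    have "(1\<^sub>m n - mat_Re K) $$ (k, l) = 1/2 * ?g k l + 1/2 * cnj (?g l k)" if "k < n" "l < n" for k l
      using that K Re mat_adjoint_carrier[OF K]
      by (simp add: mat_Re_def mat_adjoint_index field_simps)
    then have "mat_form n (\<lambda>k l. (1\<^sub>m n - mat_Re K) $$ (k, l)) v =
        (\<Sum>k<n. \<Sum>l<n. (1/2 * ?g k l + 1/2 * cnj (?g l k)) * v l * cnj (v k))"
      unfolding mat_form_def by (intro sum.cong refl) (simp only: lessThan_iff)
    also have "\<dots> = (\<Sum>k<n. \<Sum>l<n. 1/2 * (?g k l * v l * cnj (v k)) + 1/2 * cnj (?g l k * v k * cnj (v l)))"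
      by (intro sum.cong refl) (simp only: distrib_right distrib_left mult_ac complex_cnj_mult complex_cnj_cnj)
    also have "\<dots> = 1/2 * mat_form n ?g v + 1/2 * cnj (mat_form n ?g v)"
      unfolding mat_form_def sum.distrib cnj_sum sum_distrib_left
      by (subst (2) sum.swap) (rule refl)
    finally show ?thesis
      by (simp add: complex_eq_iff)
  qed
  moreover have "1\<^sub>m n - mat_Re K \<in> carrier_mat n n"
    using Re by (rule minus_carrier_mat)
  ultimately show ?thesis
    using Re by (simp add: mat_le_def mat_pos_iff complex_nonneg_iff)
qed

lemma sum_div_mod: "(\<Sum>k<m * n. g (k div n) (k mod n)) = (\<Sum>i<m. \<Sum>s<n. g i s)"
  for g :: "nat \<Rightarrow> nat \<Rightarrow> 'a::comm_monoid_add"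
proof -
  have "(\<Sum>k<m * n. g (k div n) (k mod n)) =
      (\<Sum>i<m. \<Sum>k\<in>{0 + i * n..<n + i * n}. g (k div n) (k mod n))"
    by (simp add: sum.nat_group[symmetric] add.commute)
  also have "\<dots> = (\<Sum>i<m. \<Sum>s<n. g i s)"
    by (simp only: sum.shift_bounds_nat_ivl) (auto simp: lessThan_atLeast0 intro!: sum.cong)
  finally show ?thesis .
qed

lemma mat_form_block:
  "mat_form (m * n) (\<lambda>k l. F (k div n) (l div n) (k mod n) (l mod n)) (\<lambda>k. v (k div n) (k mod n)) =
    block_form m n F v"
proof -
  let ?h = "\<lambda>i s k t. F i k s t * v k t * cnj (v i s)"
  have "mat_form (m * n) (\<lambda>k l. F (k div n) (l div n) (k mod n) (l mod n)) (\<lambda>k. v (k div n) (k mod n)) =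
      (\<Sum>k<m * n. (\<lambda>i s. \<Sum>l<m * n. ?h i s (l div n) (l mod n)) (k div n) (k mod n))"
    by (simp add: mat_form_def)
  also have "\<dots> = (\<Sum>i<m. \<Sum>s<n. \<Sum>l<m * n. ?h i s (l div n) (l mod n))"
    by (rule sum_div_mod)
  also have "\<dots> = (\<Sum>i<m. \<Sum>s<n. \<Sum>k<m. \<Sum>t<n. ?h i s k t)"
    by (intro sum.cong refl sum_div_mod)
  also have "\<dots> = block_form m n F v"
    unfolding block_form_def by (intro sum.cong refl sum.swap)
  finally show ?thesis .
qed

text \<open>Every \<open>u\<close> comes from a doubly indexed vector, namely
  \<open>v i s = u (i * n + s)\<close>. The predicate \<open>R\<close> is left open because both
  \<open>0 \<le> z\<close> and \<open>0 \<le> Re z\<close> are wanted.\<close>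

lemma all_mat_form_block:
  "(\<forall>u. R (mat_form (m * n) (\<lambda>k l. F (k div n) (l div n) (k mod n) (l mod n)) u)) \<longleftrightarrow>
    (\<forall>v. R (block_form m n F v))"
  (is "(\<forall>u. R (?f u)) \<longleftrightarrow> _")
proof
  assume all: "\<forall>u. R (?f u)"
  show "\<forall>v. R (block_form m n F v)"
    unfolding mat_form_block[symmetric] using all by blast
next
  assume all: "\<forall>v. R (block_form m n F v)"
  have "?f u = block_form m n F (\<lambda>i s. u (i * n + s))" for u
    by (simp flip: mat_form_block)
  then show "\<forall>u. R (?f u)"
    using all by simp
qed

lemma mat_form_cong:
  "(\<And>k l. k < n \<Longrightarrow> l < n \<Longrightarrow> f k l = g k l) \<Longrightarrow> mat_form n f v = mat_form n g v"
  by (simp add: mat_form_def)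

lemma mat_pos_block_iff:
  "mat_pos (m * n) (mat (m * n) (m * n) (\<lambda>(k, l). F (k div n) (l div n) (k mod n) (l mod n))) \<longleftrightarrow>
    (\<forall>v. 0 \<le> block_form m n F v)"
  by (simp add: mat_pos_iff all_mat_form_block[symmetric] cong: mat_form_cong)

lemma mat_le_Re_kron_sum_iff:
  "mat_le (m * n) (mat_Re (kron_sum m n Y X)) (1\<^sub>m (m * n)) \<longleftrightarrow>
    (\<forall>v. 0 \<le> Re (block_form m n (\<lambda>i k s t. (if i = k \<and> s = t then 1 else 0) -
      (\<Sum>j\<in>UNIV. Y j $$ (i, k) * X j $$ (s, t))) v))"
proof -
  have eq: "k = l \<longleftrightarrow> k div n = l div n \<and> k mod n = l mod n" for k l :: nat
    by (metis div_mult_mod_eq)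
  have "mat_form (m * n) (\<lambda>k l. (if k = l then 1 else 0) - kron_sum m n Y X $$ (k, l)) v =
    mat_form (m * n) (\<lambda>k l. (if k div n = l div n \<and> k mod n = l mod n then 1 else 0) -
      (\<Sum>j\<in>UNIV. Y j $$ (k div n, l div n) * X j $$ (k mod n, l mod n))) v" for v
    by (rule mat_form_cong) (simp add: kron_sum_def eq[symmetric])
  moreover have "kron_sum m n Y X \<in> carrier_mat (m * n) (m * n)"
    by (simp add: kron_sum_def)
  ultimately show ?thesis
    by (simp add: mat_le_Re_one_iff
        all_mat_form_block[where R = "\<lambda>z. 0 \<le> Re z" and F = "\<lambda>i k s t. (if i = k \<and> s = t then 1 else 0) -
          (\<Sum>j\<in>UNIV. Y j $$ (i, k) * X j $$ (s, t))"])
qed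

section \<open>Completely positive maps and pencils\<close>

text \<open>The entries of P \<otimes> I + \<Sum> L_j \<otimes> A_j. Both the pencil that defines
  the free spectrahedron and the one obtained by separation have this form.\<close>

definition pencil ::
    "(nat \<Rightarrow> nat \<Rightarrow> complex) \<Rightarrow> ('d::finite \<Rightarrow> nat \<Rightarrow> nat \<Rightarrow> complex) \<Rightarrow>
      ('d \<Rightarrow> 'h::chilbert_space \<Rightarrow>\<^sub>L 'h) \<Rightarrow> nat \<Rightarrow> nat \<Rightarrow> 'h \<Rightarrow>\<^sub>L 'h"
  where "pencil P L A i k = op_scale (P i k) id_blinfun + (\<Sum>j\<in>UNIV. op_scale (L j i k) (A j))"

text \<open>The image of \<open>pencil P L A\<close> under a unital completely positive map sending
  each \<open>A j\<close> to \<open>X j\<close>: entry \<open>(s, t)\<close> of block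
  \<open>(i, k)\<close>.\<close>

definition block_pencil ::
    "(nat \<Rightarrow> nat \<Rightarrow> complex) \<Rightarrow> ('d::finite \<Rightarrow> nat \<Rightarrow> nat \<Rightarrow> complex) \<Rightarrow>
      ('d \<Rightarrow> complex mat) \<Rightarrow> nat \<Rightarrow> nat \<Rightarrow> nat \<Rightarrow> nat \<Rightarrow> complex"
  where "block_pencil P L X i k s t = P i k * of_bool (s = t) + (\<Sum>j\<in>UNIV. L j i k * X j $$ (s, t))"

lemma blinfun_apply_sum: "blinfun_apply (\<Sum>j\<in>J. f j) x = (\<Sum>j\<in>J. blinfun_apply (f j) x)"
  by (induction J rule: infinite_finite_induct) (auto simp: blinfun.add_left)

lemma cinner_pencil:
  "cinner (pencil P L A i k x) y = P i k * cinner x y + (\<Sum>j\<in>UNIV. L j i k * cinner (A j x) y)"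
  by (simp add: pencil_def blinfun.add_left blinfun_apply_sum cinner_add_left cinner_sum_left
      cinner_scaleC_left)

lemma op_form_pencil:
  "op_form n (pencil P L A) x = (\<Sum>i<n. \<Sum>k<n. P i k * cinner (x k) (x i)) +
    (\<Sum>j\<in>UNIV. \<Sum>i<n. \<Sum>k<n. L j i k * cinner (A j (x k)) (x i))"
  unfolding op_form_def cinner_pencil sum.distrib
  by (subst sum.swap[of _ UNIV], subst sum.swap[of _ UNIV]) (rule refl)

lemma block_form_pencil:
  "block_form m n (block_pencil P L X) v = (\<Sum>i<m. \<Sum>k<m. \<Sum>s<n. P i k * v k s * cnj (v i s)) +
    (\<Sum>j\<in>UNIV. \<Sum>i<m. \<Sum>k<m. \<Sum>s<n. \<Sum>t<n. L j i k * X j $$ (s, t) * v k t * cnj (v i s))"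
proof -
  have "(\<Sum>s<n. \<Sum>t<n. block_pencil P L X i k s t * v k t * cnj (v i s)) =
      (\<Sum>s<n. P i k * v k s * cnj (v i s)) +
      (\<Sum>j\<in>UNIV. \<Sum>s<n. \<Sum>t<n. L j i k * X j $$ (s, t) * v k t * cnj (v i s))" for i k
  proof -
    have "(\<Sum>t<n. block_pencil P L X i k s t * v k t * cnj (v i s)) =
        (\<Sum>t<n. if t = s then P i k * v k t * cnj (v i s) else 0) +
        (\<Sum>t<n. \<Sum>j\<in>UNIV. L j i k * X j $$ (s, t) * v k t * cnj (v i s))" for s
      unfolding block_pencil_def sum.distrib[symmetric] sum_distrib_right distrib_right
      by (intro sum.cong refl) auto
    then have "(\<Sum>t<n. block_pencil P L X i k s t * v k t * cnj (v i s)) =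
        P i k * v k s * cnj (v i s) +
        (\<Sum>j\<in>UNIV. \<Sum>t<n. L j i k * X j $$ (s, t) * v k t * cnj (v i s))" if "s < n" for s
      using that sum.swap[of "\<lambda>t j. L j i k * X j $$ (s, t) * v k t * cnj (v i s)" UNIV "{..<n}"] by simp
    then show ?thesis
      using sum.swap[of "\<lambda>s j. \<Sum>t<n. L j i k * X j $$ (s, t) * v k t * cnj (v i s)" UNIV "{..<n}"]
      by (simp add: sum.distrib)
  qed
  then show ?thesis
    unfolding block_form_def
    using sum.swap[of "\<lambda>i j. \<Sum>k<m. \<Sum>s<n. \<Sum>t<n. L j i k * X j $$ (s, t) * v k t * cnj (v i s)" UNIV "{..<m}"]
      sum.swap[of "\<lambda>k j. \<Sum>s<n. \<Sum>t<n. L j _ k * X j $$ (s, t) * v k t * cnj (v _ s)" UNIV "{..<m}"]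
    by (simp add: sum.distrib)
qed

lemma op_adj_pencil:
  assumes "\<And>j. A j \<in> bounded_ops" and "\<And>j. op_adj (A j) = A j"
    and "P k i = cnj (P i k)" and "\<And>j. L j k i = cnj (L j i k)"
  shows "op_adj (pencil P L A i k) = pencil P L A k i"
proof (rule op_adj_eqI)
  fix x y
  have "cinner (A j x) y = cnj (cinner (A j y) x)" for j
    using cinner_op_adj[OF assms(1), of j x y] cinner_commute[of x "A j y"] by (simp add: assms(2))
  then show "cinner (pencil P L A i k x) y = cinner x (pencil P L A k i y)"
    using assms(3,4) cinner_commute[of x y]
    by (subst cinner_commute[of x]) (simp add: cinner_pencil)
qed

lemma op_scale_of_real: "op_scale (complex_of_real r) T = r *\<^sub>R T"
  by (rule blinfun_eqI) (simp add: scaleC_complex_of_real blinfun.scaleR_left)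

lemma op_scale_zero [simp]: "op_scale 0 T = 0"
  by (simp add: op_scale_of_real[of 0, simplified])

lemma op_scale_one [simp]: "op_scale 1 T = T"
  by (simp add: op_scale_of_real[of 1, simplified])

lemma op_scale_half: "op_scale (1/2) T = (1/2) *\<^sub>R T"
  by (simp add: op_scale_of_real[of "1/2", simplified])

lemma op_scale_minus [simp]: "op_scale (- c) T = - op_scale c T"
proof (rule blinfun_eqI)
  fix x
  have "(- c) *\<^sub>C T x = complex_of_real (- 1) *\<^sub>C c *\<^sub>C T x"
    unfolding scaleC_scaleC by simp
  then show "op_scale (- c) T x = (- op_scale c T) x"
    by (simp only: scaleC_complex_of_real op_scale_apply uminus_blinfun.rep_eq scaleR_minus1_left)
qed

lemma op_mat_one_minus_op_tensor_sum:
  "op_mat_one n - op_tensor_sum n A X =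
    mat n n (\<lambda>(i, k). pencil (\<lambda>i k. of_bool (i = k)) (\<lambda>j i k. - X j $$ (i, k)) A i k)"
  by (intro eq_matI) (auto simp: op_mat_one_def op_tensor_sum_def pencil_def sum_negf)

lemma cstar_add: "unital_cstar_subalgebra C \<Longrightarrow> S \<in> C \<Longrightarrow> T \<in> C \<Longrightarrow> S + T \<in> C"
  and cstar_op_scale: "unital_cstar_subalgebra C \<Longrightarrow> T \<in> C \<Longrightarrow> op_scale c T \<in> C"
  and cstar_id: "unital_cstar_subalgebra C \<Longrightarrow> id_blinfun \<in> C"
  and cstar_op_adj: "unital_cstar_subalgebra C \<Longrightarrow> T \<in> C \<Longrightarrow> op_adj T \<in> C"
  and cstar_bounded_ops: "unital_cstar_subalgebra C \<Longrightarrow> T \<in> C \<Longrightarrow> T \<in> bounded_ops"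
  by (auto simp: unital_cstar_subalgebra_def)

lemma cstar_zero: "unital_cstar_subalgebra C \<Longrightarrow> 0 \<in> C"
  using cstar_op_scale[OF _ cstar_id, of C 0] by simp

lemma cstar_sum: "unital_cstar_subalgebra C \<Longrightarrow> (\<And>j. j \<in> J \<Longrightarrow> f j \<in> C) \<Longrightarrow> (\<Sum>j\<in>J. f j) \<in> C"
  by (induction J rule: infinite_finite_induct) (auto intro: cstar_zero cstar_add)

lemma cstar_pencil: "unital_cstar_subalgebra C \<Longrightarrow> (\<And>j. A j \<in> C) \<Longrightarrow> pencil P L A i k \<in> C"
  unfolding pencil_def by (intro cstar_add cstar_sum cstar_op_scale cstar_id)

section \<open>Unital completely positive maps: adjoints and real parts\<close>

context
  fixes C :: "('h::chilbert_space \<Rightarrow>\<^sub>L 'h) set" and n :: nat and \<phi>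
  assumes C: "unital_cstar_subalgebra C" and \<phi>: "ucp_map C n \<phi>"
begin

lemma ucp_carrier: "T \<in> C \<Longrightarrow> \<phi> T \<in> carrier_mat n n"
  using \<phi> by (simp add: ucp_map_def)

lemma ucp_add: "S \<in> C \<Longrightarrow> T \<in> C \<Longrightarrow> s < n \<Longrightarrow> t < n \<Longrightarrow> \<phi> (S + T) $$ (s, t) = \<phi> S $$ (s, t) + \<phi> T $$ (s, t)"
  using \<phi> ucp_carrier[of S] ucp_carrier[of T] by (auto simp: ucp_map_def)

lemma ucp_op_scale: "T \<in> C \<Longrightarrow> s < n \<Longrightarrow> t < n \<Longrightarrow> \<phi> (op_scale c T) $$ (s, t) = c * \<phi> T $$ (s, t)"
  using \<phi> ucp_carrier[of T] by (auto simp: ucp_map_def)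

lemma ucp_id: "\<phi> id_blinfun = 1\<^sub>m n"
  using \<phi> by (simp add: ucp_map_def)

lemma ucp_sum:
  assumes "s < n" "t < n" "\<And>j. j \<in> J \<Longrightarrow> f j \<in> C"
  shows "\<phi> (\<Sum>j\<in>J. f j) $$ (s, t) = (\<Sum>j\<in>J. \<phi> (f j) $$ (s, t))"
proof -
  have "\<phi> 0 $$ (s, t) = 0"
    using ucp_op_scale[OF cstar_id[OF C] assms(1,2), of 0] by simp
  then show ?thesis
    using assms(3)
    by (induction J rule: infinite_finite_induct) (auto simp: ucp_add assms(1,2) cstar_sum[OF C])
qed

lemma ucp_pencil:
  assumes "\<And>j. A j \<in> C" "s < n" "t < n"
  shows "\<phi> (pencil P L A i k) $$ (s, t) = block_pencil P L (\<lambda>j. \<phi> (A j)) i k s t"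
  using assms cstar_op_scale[OF C cstar_id[OF C]] cstar_op_scale[OF C assms(1)]
  by (simp add: pencil_def block_pencil_def ucp_add ucp_sum ucp_op_scale ucp_id cstar_sum[OF C]
      cstar_id[OF C])

lemma ucp_positive:
  assumes "0 < m" and "\<And>i k. i < m \<Longrightarrow> k < m \<Longrightarrow> M i k \<in> C" and "\<And>x. 0 \<le> op_form m M x"
  shows "mat_pos (m * n) (amplify m n \<phi> (mat m m (\<lambda>(i, k). M i k)))"
proof -
  have "elements_mat (mat m m (\<lambda>(i, k). M i k)) \<subseteq> C"
    using assms(2) by (auto simp: elements_mat_def)
  moreover have "op_mat_pos m (mat m m (\<lambda>(i, k). M i k))"
    using assms(3) by (simp add: op_mat_pos_iff op_form_def)
  ultimately show ?thesis
    using \<phi> assms(1) by (simp add: ucp_map_def)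
qed

text \<open>The 2 by 2 operator matrix with \<open>norm T\<close> times the identity on the diagonal
  and \<open>T\<close>, \<open>op_adj T\<close> off it is positive. Its image is therefore positive,
  hence Hermitian, and the claim compares the two off-diagonal blocks.\<close>

lemma ucp_op_adj:
  assumes T: "T \<in> C"
  shows "\<phi> (op_adj T) = mat_adjoint (\<phi> T)"
proof -
  define M where "M i k = (if i = k then op_scale (complex_of_real (norm T)) id_blinfun
    else if i = 0 then T else op_adj T)" for i k :: nat
  have "0 \<le> op_form 2 M x" for x
  proof -
    have "op_form 2 M x = complex_of_real (norm T) * cinner (x 0) (x 0) +
        complex_of_real (norm T) * cinner (x 1) (x 1) +
        (cinner (T (x 1)) (x 0) + cnj (cinner (T (x 1)) (x 0)))"
      using cinner_op_adj_left[OF cstar_bounded_ops[OF C T], of "x 0" "x 1"]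
        cinner_commute[of "x 0" "T (x 1)"]
      by (simp add: op_form_def M_def numeral_2_eq_2 cinner_scaleC_left)
    also have "\<dots> = complex_of_real (norm T * (norm (x 0))\<^sup>2 + norm T * (norm (x 1))\<^sup>2 +
        2 * Re (cinner (T (x 1)) (x 0)))"
      by (simp add: cinner_self complex_eq_iff)
    finally have eq: "op_form 2 M x = complex_of_real (norm T * (norm (x 0))\<^sup>2 + norm T * (norm (x 1))\<^sup>2 +
        2 * Re (cinner (T (x 1)) (x 0)))" .
    have "cmod (cinner (T (x 1)) (x 0)) \<le> norm (T (x 1)) * norm (x 0)"
      by (rule cinner_bound)
    also have "\<dots> \<le> norm T * norm (x 1) * norm (x 0)"
      by (intro mult_right_mono norm_blinfun) simp
    finally have "- (norm T * norm (x 1) * norm (x 0)) \<le> Re (cinner (T (x 1)) (x 0))"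
      using abs_Re_le_cmod[of "cinner (T (x 1)) (x 0)"] by linarith
    moreover have "0 \<le> norm T * (norm (x 0) - norm (x 1))\<^sup>2"
      by simp
    then have "2 * (norm T * norm (x 1) * norm (x 0)) \<le> norm T * (norm (x 0))\<^sup>2 + norm T * (norm (x 1))\<^sup>2"
      by (simp add: power2_diff algebra_simps)
    ultimately show ?thesis
      unfolding eq by (simp add: complex_nonneg_iff)
  qed
  moreover have "M i k \<in> C" for i k
    using T by (auto simp: M_def intro: cstar_op_scale[OF C] cstar_id[OF C] cstar_op_adj[OF C])
  ultimately have pos: "mat_pos (2 * n) (amplify 2 n \<phi> (mat 2 2 (\<lambda>(i, k). M i k)))"
    by (intro ucp_positive) auto
  let ?G = "\<lambda>k l. amplify 2 n \<phi> (mat 2 2 (\<lambda>(i, k). M i k)) $$ (k, l)"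
  have "amplify 2 n \<phi> (mat 2 2 (\<lambda>(i, k). M i k)) \<in> carrier_mat (2 * n) (2 * n)"
    by (simp add: amplify_def)
  then have herm: "?G a b = cnj (?G b a)" if "a < 2 * n" "b < 2 * n" for a b
    using pos that by (intro mat_form_hermitian[where f = ?G]) (auto simp: mat_pos_iff)
  have "cnj (\<phi> T $$ (t, s)) = \<phi> (op_adj T) $$ (s, t)" if "s < n" "t < n" for s t
  proof -
    \<comment> \<open>Index \<open>n + s\<close> lies in block 1 and index \<open>t\<close> in block
      0.\<close>
    have "?G (n + s) t = \<phi> (op_adj T) $$ (s, t)" "?G t (n + s) = \<phi> T $$ (t, s)"
      using that by (auto simp: amplify_def M_def)
    then show ?thesis
      using herm[of "n + s" t] that by simp
  qed
  then show ?thesis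
    using mat_adjoint_eq_iff[OF ucp_carrier[OF T] ucp_carrier[OF cstar_op_adj[OF C T]]] by simp
qed

text \<open>The real part of \<open>N\<close> is a positive matrix over \<open>C\<close>, so
  complete positivity applies to it; as \<open>\<phi>\<close> respects adjoints, the form of the
  image is the real part of the form of \<open>\<phi>(N)\<close>. The case \<open>m = 0\<close> is
  separate because \<open>ucp_map\<close> speaks of \<open>0 < m\<close> only.\<close>

lemma ucp_Re_positive:
  assumes N: "\<And>i k. i < m \<Longrightarrow> k < m \<Longrightarrow> N i k \<in> C" and pos: "\<And>x. 0 \<le> Re (op_form m N x)"
  shows "0 \<le> Re (block_form m n (\<lambda>i k s t. \<phi> (N i k) $$ (s, t)) v)"
proof (cases "m = 0")
  case False
  define M where "M i k = op_mat_Re (mat m m (\<lambda>(i, k). N i k)) $$ (i, k)" for i k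
  have B: "mat m m (\<lambda>(i, k). N i k) $$ (i, k) \<in> bounded_ops" if "i < m" "k < m" for i k
    using that N cstar_bounded_ops[OF C] by simp
  have M: "M i k = op_scale (1/2) (N i k) + op_scale (1/2) (op_adj (N k i))" if "i < m" "k < m" for i k
    using that by (simp add: M_def op_mat_Re_def op_mat_adj_def scaleR_add_right op_scale_half)
  have "op_form m N x = op_form m (\<lambda>i k. mat m m (\<lambda>(i, k). N i k) $$ (i, k)) x" for x
    by (simp add: op_form_def)
  then have "0 \<le> op_form m M x" for x
    using op_form_op_mat_Re[OF mat_carrier B] pos[of x] unfolding M_def
    by (simp add: complex_nonneg_iff)
  moreover have MC: "M i k \<in> C" if "i < m" "k < m" for i k
    using that N by (simp add: M cstar_add[OF C] cstar_op_scale[OF C] cstar_op_adj[OF C])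
  ultimately have "mat_pos (m * n) (amplify m n \<phi> (mat m m (\<lambda>(i, k). M i k)))"
    using False by (intro ucp_positive) auto
  also have "amplify m n \<phi> (mat m m (\<lambda>(i, k). M i k)) = mat (m * n) (m * n)
      (\<lambda>(k, l). (\<lambda>i k s t. \<phi> (M i k) $$ (s, t)) (k div n) (l div n) (k mod n) (l mod n))"
    unfolding amplify_def
    by (intro cong_mat refl) (auto simp: less_mult_imp_div_less)
  finally have "0 \<le> block_form m n (\<lambda>i k s t. \<phi> (M i k) $$ (s, t)) v"
    by (subst (asm) mat_pos_block_iff) blast
  moreover have "block_form m n (\<lambda>i k s t. \<phi> (M i k) $$ (s, t)) v =
      of_real (Re (block_form m n (\<lambda>i k s t. \<phi> (N i k) $$ (s, t)) v))"
  proof -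
    let ?g = "\<lambda>i k s t. \<phi> (N i k) $$ (s, t) * v k t * cnj (v i s)"
    have entry: "\<phi> (M i k) $$ (s, t) = 1/2 * \<phi> (N i k) $$ (s, t) + 1/2 * cnj (\<phi> (N k i) $$ (t, s))"
      if "i < m" "k < m" "s < n" "t < n" for i k s t
      using that N ucp_carrier
      by (simp add: M ucp_add ucp_op_scale ucp_op_adj mat_adjoint_index[where n = n] cstar_op_scale[OF C]
          cstar_op_adj[OF C])
    have "block_form m n (\<lambda>i k s t. \<phi> (M i k) $$ (s, t)) v =
        (\<Sum>i<m. \<Sum>k<m. \<Sum>s<n. \<Sum>t<n. 1/2 * ?g i k s t + 1/2 * cnj (?g k i t s))"
      unfolding block_form_def by (intro sum.cong refl) (simp add: entry distrib_left mult_ac)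
    also have "\<dots> = (\<Sum>i<m. \<Sum>k<m. \<Sum>s<n. \<Sum>t<n. 1/2 * ?g i k s t) +
        (\<Sum>i<m. \<Sum>k<m. \<Sum>s<n. \<Sum>t<n. 1/2 * cnj (?g k i t s))"
      by (simp only: sum.distrib)
    also have "(\<Sum>i<m. \<Sum>k<m. \<Sum>s<n. \<Sum>t<n. 1/2 * cnj (?g k i t s)) =
        (\<Sum>k<m. \<Sum>i<m. \<Sum>t<n. \<Sum>s<n. 1/2 * cnj (?g k i t s))"
      by (subst sum.swap) (intro sum.cong refl sum.swap)
    also have "\<dots> = 1/2 * cnj (\<Sum>i<m. \<Sum>k<m. \<Sum>s<n. \<Sum>t<n. ?g i k s t)"
      by (simp only: cnj_sum sum_distrib_left)
    also have "(\<Sum>i<m. \<Sum>k<m. \<Sum>s<n. \<Sum>t<n. 1/2 * ?g i k s t) = 1/2 * (\<Sum>i<m. \<Sum>k<m. \<Sum>s<n. \<Sum>t<n. ?g i k s t)"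
      by (simp only: sum_distrib_left)
    also have "1/2 * z + 1/2 * cnj z = complex_of_real (Re z)" for z
      by (simp add: complex_eq_iff)
    finally show ?thesis
      unfolding block_form_def .
  qed
  ultimately show ?thesis
    by (simp add: complex_nonneg_iff)
qed (simp add: block_form_def)

text \<open>Used twice: for the polar inequality on the matrix range, and, with a map that kills
  \<open>A\<close>, for the positivity of the constant term of a pencil.\<close>

lemma ucp_pencil_positive:
  assumes A: "\<And>j. A j \<in> C" and pos: "\<And>x. 0 \<le> Re (op_form m (pencil P L A) x)"
  shows "0 \<le> Re (block_form m n (block_pencil P L (\<lambda>j. \<phi> (A j))) v)"
proof -
  have "block_form m n (block_pencil P L (\<lambda>j. \<phi> (A j))) v =
      block_form m n (\<lambda>i k s t. \<phi> (pencil P L A i k) $$ (s, t)) v"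
    by (simp add: block_form_def ucp_pencil[OF A])
  moreover have "pencil P L A i k \<in> C" for i k
    using C A by (rule cstar_pencil)
  ultimately show ?thesis
    using ucp_Re_positive[of m "pencil P L A" v] pos by simp
qed

end

section \<open>Free spectrahedra and polar conditions in terms of pencils\<close>

text \<open>The index type is nonempty, so the entry at \<open>undefined\<close> already fixes the
  size. The unions over all sizes can thus be read one size at a time.\<close>

lemma mat_tuples_level_iff:
  fixes X :: "'d::finite \<Rightarrow> complex mat"
  assumes "X \<in> mat_tuples n"
  shows "X \<in> mat_tuples m \<longleftrightarrow> m = n"
proof
  assume "X \<in> mat_tuples m"
  then have "X undefined \<in> carrier_mat m m" "X undefined \<in> carrier_mat n n"
    using assms by (auto simp: mat_tuples_def)
  then show "m = n"
    by auto
qed (simp add: assms)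

lemma free_spectrahedron_iff:
  assumes A: "\<And>j. A j \<in> bounded_ops" and X: "X \<in> mat_tuples n" "1 \<le> n"
  shows "X \<in> free_spectrahedron A \<longleftrightarrow>
    (\<forall>x. 0 \<le> Re (op_form n (pencil (\<lambda>i k. of_bool (i = k)) (\<lambda>j i k. - X j $$ (i, k)) A) x))"
proof -
  let ?N = "pencil (\<lambda>i k. of_bool (i = k)) (\<lambda>j i k. - X j $$ (i, k)) A"
  have "X \<in> free_spectrahedron A \<longleftrightarrow> op_mat_pos n (op_mat_Re (op_mat_one n - op_tensor_sum n A X))"
    using X by (auto simp: free_spectrahedron_def mat_tuples_level_iff[OF X(1)])
  also have "\<dots> \<longleftrightarrow> (\<forall>x. 0 \<le> Re (op_form n (\<lambda>i k. mat n n (\<lambda>(i, k). ?N i k) $$ (i, k)) x))"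
    unfolding op_mat_one_minus_op_tensor_sum
    by (intro op_mat_pos_Re_iff) (auto intro: cstar_pencil[OF unital_cstar_subalgebra_bounded_ops A])
  also have "\<dots> \<longleftrightarrow> (\<forall>x. 0 \<le> Re (op_form n ?N x))"
    by (simp add: op_form_def)
  finally show ?thesis .
qed

text \<open>For self-adjoint data the operator matrix equals its own adjoint, so taking its real
  part changes nothing. This reduces the self-adjoint setting to the general one.\<close>

lemma sa_free_spectrahedron_iff:
  assumes A: "\<And>j. A j \<in> bounded_ops" "\<And>j. op_adj (A j) = A j" and X: "X \<in> sa_mat_tuples n" "1 \<le> n"
  shows "X \<in> sa_free_spectrahedron A \<longleftrightarrow> X \<in> free_spectrahedron A"
proof -
  have Xm: "X \<in> mat_tuples n"
    using X by (simp add: sa_mat_tuples_def)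
  have herm: "X j $$ (k, i) = cnj (X j $$ (i, k))" if "i < n" "k < n" for i j k
    using X that mat_adjoint_index[of "X j" n k i] by (simp add: sa_mat_tuples_def mat_tuples_def)
  let ?M = "op_mat_one n - op_tensor_sum n A X"
  let ?N = "pencil (\<lambda>i k. of_bool (i = k)) (\<lambda>j i k. - X j $$ (i, k)) A"
  have "op_adj (?N k i) = ?N i k" if "i < n" "k < n" for i k
    using herm[OF that(2,1)] by (intro op_adj_pencil A) (simp_all add: eq_commute)
  then have "op_mat_Re ?M = ?M"
    unfolding op_mat_one_minus_op_tensor_sum
    by (intro eq_matI) (simp_all add: op_mat_Re_def op_mat_adj_def scaleR_2[symmetric])
  moreover have "X \<in> sa_free_spectrahedron A \<longleftrightarrow> op_mat_pos n ?M"
    using X by (auto simp: sa_free_spectrahedron_def sa_mat_tuples_def mat_tuples_level_iff[OF Xm])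
  moreover have "X \<in> free_spectrahedron A \<longleftrightarrow> op_mat_pos n (op_mat_Re ?M)"
    using X(2) by (auto simp: free_spectrahedron_def mat_tuples_level_iff[OF Xm])
  ultimately show ?thesis
    by simp
qed

lemma polar_condition_iff:
  "mat_le (m * n) (mat_Re (kron_sum m n Y X)) (1\<^sub>m (m * n)) \<longleftrightarrow>
    (\<forall>v. 0 \<le> Re (block_form m n
      (block_pencil (\<lambda>i k. of_bool (i = k)) (\<lambda>j i k. - Y j $$ (i, k)) X) v))"
proof -
  have "(\<lambda>i k s t. (if i = k \<and> s = t then 1 else 0) - (\<Sum>j\<in>UNIV. Y j $$ (i, k) * X j $$ (s, t))) =
      block_pencil (\<lambda>i k. of_bool (i = k)) (\<lambda>j i k. - Y j $$ (i, k)) X"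
    by (auto simp: block_pencil_def fun_eq_iff sum_negf)
  then show ?thesis
    by (simp add: mat_le_Re_kron_sum_iff)
qed

text \<open>The Kronecker sum of self-adjoint tuples is self-adjoint and so coincides with its real
  part.\<close>

lemma sa_polar_condition_iff:
  assumes "Y \<in> sa_mat_tuples m" "X \<in> sa_mat_tuples n"
  shows "mat_le (m * n) (kron_sum m n Y X) (1\<^sub>m (m * n)) \<longleftrightarrow>
    mat_le (m * n) (mat_Re (kron_sum m n Y X)) (1\<^sub>m (m * n))"
proof -
  have K: "kron_sum m n Y X \<in> carrier_mat (m * n) (m * n)"
    by (simp add: kron_sum_def)
  have herm: "cnj (X j $$ (i, k)) = X j $$ (k, i)" if "X \<in> sa_mat_tuples n" "i < n" "k < n"
    for i j k n and X :: "'a \<Rightarrow> complex mat"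
    using that mat_adjoint_index[of "X j" n k i] by (simp add: sa_mat_tuples_def mat_tuples_def)
  have "mat_adjoint (kron_sum m n Y X) = kron_sum m n Y X"
    unfolding mat_adjoint_eq_iff[OF K K]
  proof (intro allI impI)
    fix k l assume "k < m * n" "l < m * n"
    moreover from this have "0 < n"
      by (cases n) auto
    ultimately show "cnj (kron_sum m n Y X $$ (l, k)) = kron_sum m n Y X $$ (k, l)"
      by (simp add: kron_sum_def herm[OF assms(1)] herm[OF assms(2)] less_mult_imp_div_less)
  qed
  then have "mat_Re (kron_sum m n Y X) = kron_sum m n Y X"
    using K by (auto simp: mat_Re_def)
  then show ?thesis
    by simp
qed

lemma matrix_range_polar:
  assumes A: "\<forall>j. A j \<in> bounded_ops" and X: "X \<in> matrix_range_level n A"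
    and Y: "Y \<in> free_spectrahedron A \<inter> mat_tuples m" "1 \<le> m"
  shows "mat_le (m * n) (mat_Re (kron_sum m n Y X)) (1\<^sub>m (m * n))"
proof -
  obtain \<phi> where \<phi>: "ucp_map (cstar_generated A) n \<phi>" and X_eq: "X = (\<lambda>j. \<phi> (A j))"
    using X by (auto simp: matrix_range_level_def)
  have "\<forall>x. 0 \<le> Re (op_form m (pencil (\<lambda>i k. of_bool (i = k)) (\<lambda>j i k. - Y j $$ (i, k)) A) x)"
    using Y A free_spectrahedron_iff[of A Y m] by simp
  then show ?thesis
    unfolding polar_condition_iff X_eq
    by (intro allI ucp_pencil_positive[OF unital_cstar_subalgebra_cstar_generated(1)[OF A] \<phi>]
        unital_cstar_subalgebra_cstar_generated(2)[OF A]) blast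
qed

lemma matrix_range_level_mat_tuples:
  assumes "\<forall>j. A j \<in> bounded_ops" "X \<in> matrix_range_level n A"
  shows "X \<in> mat_tuples n"
  using assms ucp_carrier unital_cstar_subalgebra_cstar_generated(2)[OF assms(1)]
  by (auto simp: matrix_range_level_def mat_tuples_def ucp_map_def)

text \<open>Unital completely positive maps respect adjoints, by \<open>ucp_op_adj\<close>.\<close>

lemma matrix_range_level_sa_mat_tuples:
  assumes A: "\<forall>j. A j \<in> bounded_ops" "\<forall>j. op_adj (A j) = A j" and X: "X \<in> matrix_range_level n A"
  shows "X \<in> sa_mat_tuples n"
proof -
  obtain \<phi> where \<phi>: "ucp_map (cstar_generated A) n \<phi>" and X_eq: "X = (\<lambda>j. \<phi> (A j))"
    using X by (auto simp: matrix_range_level_def)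
  have "mat_adjoint (X j) = X j" for j
    using ucp_op_adj[OF unital_cstar_subalgebra_cstar_generated(1)[OF A(1)] \<phi>
        unital_cstar_subalgebra_cstar_generated(2)[OF A(1)], of j] A(2) by (simp add: X_eq)
  then show ?thesis
    using matrix_range_level_mat_tuples[OF A(1) X] by (simp add: sa_mat_tuples_def)
qed

section \<open>Separation from a cone\<close>

text \<open>Divide by \<open>t\<close> and let \<open>t\<close> tend to 0. The bound \<delta> is
  there because only short steps stay inside the truncated cone to which this is applied.\<close>

lemma first_variation_nonneg:
  fixes G H \<delta> :: real
  assumes "0 < \<delta>" and var: "\<And>t. 0 < t \<Longrightarrow> t \<le> \<delta> \<Longrightarrow> 0 \<le> 2 * t * G + t\<^sup>2 * H"
  shows "0 \<le> G"
proof (rule ccontr)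
  assume G: "\<not> 0 \<le> G"
  \<comment> \<open>Small enough that \<open>t * H \<le> - G\<close>, hence
    \<open>2 * G + t * H \<le> G < 0\<close>.\<close>
  define t where "t = min \<delta> (- G / (1 + \<bar>H\<bar>))"
  have t: "0 < t" "t \<le> \<delta>" "t \<le> - G / (1 + \<bar>H\<bar>)"
    using G \<open>0 < \<delta>\<close> by (auto simp: t_def divide_neg_pos)
  have "t * H \<le> t * \<bar>H\<bar>"
    using t(1) by simp
  also have "\<dots> \<le> t * (1 + \<bar>H\<bar>)"
    using t(1) by simp
  also have "\<dots> \<le> - G"
    using t(3) pos_le_divide_eq[of "1 + \<bar>H\<bar>" t "- G"] by linarith
  finally have "2 * G + t * H < 0"
    using G by simp
  then have "t * (2 * G + t * H) < 0"
    using t(1) by (simp add: mult_pos_neg)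
  then show False
    using var[OF t(1,2)] by (simp add: power2_eq_square algebra_simps)
qed

text \<open>
  The bound makes each set of cone elements with bounded \<open>J0\<close>-sum compact by Tychonoff's theorem;
  \<open>r\<close> is the gradient of the squared distance to \<open>z\<close> at a nearest point of the cone.
\<close>

lemma cone_separation:
  fixes K :: "('b \<Rightarrow> complex) set" and z :: "'j \<Rightarrow> complex"
  assumes "closed K" and zero: "(\<lambda>_. 0) \<in> K"
    and add: "\<And>\<theta> \<eta>. \<theta> \<in> K \<Longrightarrow> \<eta> \<in> K \<Longrightarrow> (\<lambda>b. \<theta> b + \<eta> b) \<in> K"
    and scale: "\<And>\<theta> t. \<theta> \<in> K \<Longrightarrow> 0 \<le> t \<Longrightarrow> (\<lambda>b. complex_of_real t * \<theta> b) \<in> K"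
    and J: "finite J" "J0 \<subseteq> J"
    and c: "\<And>b. 0 \<le> c b"
    and bound: "\<And>\<theta> b. \<theta> \<in> K \<Longrightarrow> cmod (\<theta> b) \<le> c b * Re (\<Sum>j\<in>J0. \<theta> (e j))"
    and miss: "\<And>\<theta>. \<theta> \<in> K \<Longrightarrow> \<exists>j\<in>J. \<theta> (e j) \<noteq> z j"
  obtains r where "\<And>\<theta>. \<theta> \<in> K \<Longrightarrow> 0 \<le> Re (\<Sum>j\<in>J. r j * \<theta> (e j))"
    and "Re (\<Sum>j\<in>J. r j * z j) < 0"
proof -
  define f where "f \<theta> = (\<Sum>j\<in>J. (cmod (\<theta> (e j) - z j))\<^sup>2)" for \<theta>
  define \<tau> where "\<tau> \<theta> = Re (\<Sum>j\<in>J0. \<theta> (e j))" for \<theta> :: "'b \<Rightarrow> complex"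
  \<comment> \<open>At a minimizer the distance to each \<open>z j\<close> is controlled by
    \<open>f (\<lambda>_. 0)\<close>, through \<open>2 * a \<le> 1 + a\<^sup>2\<close>. The sum
    bounds \<tau> there, and the final 1 is room for variations, so the truncation at
    \<open>B\<close> is not active near the minimizer.\<close>
  define B where "B = (\<Sum>j\<in>J0. cmod (z j) + 1 + f (\<lambda>_. 0)) + 1"
  have f_nonneg: "0 \<le> f \<theta>" for \<theta>
    unfolding f_def by (intro sum_nonneg) simp
  have B_pos: "1 \<le> B"
    unfolding B_def using f_nonneg by (simp add: sum_nonneg)
  have cont_eval: "continuous_on UNIV (\<lambda>\<theta> :: 'b \<Rightarrow> complex. \<theta> b)" for b
    by simp
  define KB where "KB = (PiE UNIV (\<lambda>b. cball 0 (c b * B)) \<inter> K) \<inter> {\<theta>. \<tau> \<theta> \<le> B}"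
  have "compactin (product_topology (\<lambda>b. euclidean) UNIV) (PiE UNIV (\<lambda>b. cball (0 :: complex) (c b * B)))"
    by (subst compactin_PiE) simp
  then have "compact (PiE UNIV (\<lambda>b. cball (0 :: complex) (c b * B)))"
    by (simp add: euclidean_product_topology)
  moreover have "closed {\<theta>. \<tau> \<theta> \<le> B}"
    unfolding \<tau>_def by (intro closed_Collect_le continuous_intros cont_eval)
  ultimately have "compact KB"
    unfolding KB_def using \<open>closed K\<close> by (intro compact_Int_closed)
  have in_KB: "\<theta> \<in> KB" if "\<theta> \<in> K" "\<tau> \<theta> \<le> B" for \<theta>
  proof -
    have "cmod (\<theta> b) \<le> c b * B" for b
      using bound[OF that(1), of b] mult_left_mono[OF that(2) c[of b]] unfolding \<tau>_def by linarith
    then show ?thesis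
      unfolding KB_def using that by auto
  qed
  have zero_KB: "(\<lambda>_. 0) \<in> KB"
    using zero B_pos by (intro in_KB) (simp_all add: \<tau>_def)
  have "continuous_on KB f"
    unfolding f_def
    by (intro continuous_intros continuous_on_subset[OF cont_eval]) auto
  from continuous_attains_inf[OF \<open>compact KB\<close> _ this]
  obtain \<theta> where \<theta>: "\<theta> \<in> KB" and min: "\<And>\<eta>. \<eta> \<in> KB \<Longrightarrow> f \<theta> \<le> f \<eta>"
    using zero_KB by blast
  have "\<theta> \<in> K"
    using \<theta> by (simp add: KB_def)
  have "\<tau> \<theta> \<le> (\<Sum>j\<in>J0. cmod (z j) + 1 + f (\<lambda>_. 0))"
    unfolding \<tau>_def Re_sum
  proof (rule sum_mono)
    fix j assume "j \<in> J0"
    then have "(cmod (\<theta> (e j) - z j))\<^sup>2 \<le> f \<theta>"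
      unfolding f_def using J by (intro member_le_sum) auto
    moreover have "f \<theta> \<le> f (\<lambda>_. 0)"
      by (rule min[OF zero_KB])
    moreover have "2 * cmod (\<theta> (e j) - z j) \<le> 1 + (cmod (\<theta> (e j) - z j))\<^sup>2"
      using zero_le_power2[of "cmod (\<theta> (e j) - z j) - 1"] by (simp add: power2_diff)
    moreover have "Re (\<theta> (e j)) \<le> cmod (z j) + cmod (\<theta> (e j) - z j)"
      using complex_Re_le_cmod[of "\<theta> (e j)"] norm_triangle_sub[of "\<theta> (e j)" "z j"] by linarith
    ultimately show "Re (\<theta> (e j)) \<le> cmod (z j) + 1 + f (\<lambda>_. 0)"
      using norm_ge_zero[of "\<theta> (e j) - z j"] by linarith
  qed
  then have \<tau>_less: "\<tau> \<theta> + 1 \<le> B"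
    by (simp add: B_def)
  define r where "r j = cnj (\<theta> (e j) - z j)" for j
  have expand: "f (\<lambda>b. \<theta> b + complex_of_real t * \<eta> b) =
      f \<theta> + (2 * t * Re (\<Sum>j\<in>J. r j * \<eta> (e j)) + t\<^sup>2 * (\<Sum>j\<in>J. (cmod (\<eta> (e j)))\<^sup>2))" for t \<eta>
  proof -
    have "(cmod (\<theta> (e j) + complex_of_real t * \<eta> (e j) - z j))\<^sup>2 =
      (cmod (\<theta> (e j) - z j))\<^sup>2 + (2 * t * Re (r j * \<eta> (e j)) + t\<^sup>2 * (cmod (\<eta> (e j)))\<^sup>2)" for j
      unfolding r_def cmod_power2 by (simp add: power2_eq_square algebra_simps)
    then show ?thesis
      by (simp add: f_def sum.distrib sum_distrib_left)
  qed
  have \<tau>_expand: "\<tau> (\<lambda>b. \<theta> b + complex_of_real t * \<eta> b) = \<tau> \<theta> + t * \<tau> \<eta>" for t \<eta>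
    by (simp add: \<tau>_def sum.distrib sum_distrib_left)
  have pos: "0 \<le> Re (\<Sum>j\<in>J. r j * \<eta> (e j))" if "\<eta> \<in> K" for \<eta>
  \<comment> \<open>For such steps \<open>t * \<tau> \<eta> \<le> 1\<close>, which the room left in
    \<open>B\<close> absorbs.\<close>
  proof (rule first_variation_nonneg[where \<delta> = "1 / (1 + \<bar>\<tau> \<eta>\<bar>)"])
    fix t assume t: "0 < t" "t \<le> 1 / (1 + \<bar>\<tau> \<eta>\<bar>)"
    have "t * \<tau> \<eta> \<le> t * (1 + \<bar>\<tau> \<eta>\<bar>)"
      using t(1) by (intro mult_left_mono) auto
    also have "\<dots> \<le> 1"
      using t(2) by (simp add: pos_le_divide_eq)
    finally have "(\<lambda>b. \<theta> b + complex_of_real t * \<eta> b) \<in> KB"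
      using \<tau>_less t(1) \<open>\<theta> \<in> K\<close> that by (intro in_KB add scale) (auto simp: \<tau>_expand)
    from min[OF this] show "0 \<le> 2 * t * Re (\<Sum>j\<in>J. r j * \<eta> (e j)) + t\<^sup>2 * (\<Sum>j\<in>J. (cmod (\<eta> (e j)))\<^sup>2)"
      unfolding expand by simp
  qed simp
  \<comment> \<open>Shrinking \<theta> towards 0 is an admissible variation as well. So the pairing
    of \<open>r\<close> with \<theta> is at most 0, and the pairing with \<open>z\<close> is smaller
    than that by \<open>f \<theta>\<close>, which is positive.\<close>
  have "0 \<le> - Re (\<Sum>j\<in>J. r j * \<theta> (e j))"
  proof (rule first_variation_nonneg[where \<delta> = 1])
    fix t :: real assume t: "0 < t" "t \<le> 1"
    have "(\<lambda>b. complex_of_real (1 - t) * \<theta> b) \<in> K"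
      using t \<open>\<theta> \<in> K\<close> by (intro scale) auto
    then have in_K: "(\<lambda>b. \<theta> b + complex_of_real (- t) * \<theta> b) \<in> K"
      by (simp add: algebra_simps)
    have "(1 - t) * \<tau> \<theta> \<le> B"
    proof (cases "0 \<le> \<tau> \<theta>")
      case True
      then have "(1 - t) * \<tau> \<theta> \<le> 1 * \<tau> \<theta>"
        using t by (intro mult_right_mono) auto
      then show ?thesis
        using \<tau>_less by simp
    next
      case False
      then have "(1 - t) * \<tau> \<theta> \<le> 0"
        using t by (simp add: mult_nonneg_nonpos)
      then show ?thesis
        using B_pos by simp
    qed
    then have "(\<lambda>b. \<theta> b + complex_of_real (- t) * \<theta> b) \<in> KB"
      by (intro in_KB in_K) (simp only: \<tau>_expand, simp add: algebra_simps)
    from min[OF this] show "0 \<le> 2 * t * - Re (\<Sum>j\<in>J. r j * \<theta> (e j)) + t\<^sup>2 * (\<Sum>j\<in>J. (cmod (\<theta> (e j)))\<^sup>2)"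
      unfolding expand by simp
  qed simp
  moreover have "Re (\<Sum>j\<in>J. r j * z j) = Re (\<Sum>j\<in>J. r j * \<theta> (e j)) - f \<theta>"
  proof -
    have "Re (r j * z j) = Re (r j * \<theta> (e j)) - (cmod (\<theta> (e j) - z j))\<^sup>2" for j
      unfolding r_def cmod_power2 by (simp add: power2_eq_square algebra_simps)
    then show ?thesis
      by (simp add: f_def sum_subtractf)
  qed
  moreover have "0 < f \<theta>"
  proof -
    obtain j where "j \<in> J" "\<theta> (e j) \<noteq> z j"
      using miss[OF \<open>\<theta> \<in> K\<close>] by blast
    then show ?thesis
      unfolding f_def using J(1) by (intro sum_pos2[of _ j]) auto
  qed
  ultimately show thesis
    using pos by (intro that[of r]) auto
qed

text \<open>
  Gram--Schmidt for the form \<open>p\<close>: as the \<open>k\<close>-th vector has \<open>k\<close>-th coordinate nonzero and later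
  coordinates zero, the process never meets a null vector.
\<close>

lemma gram_schmidt_form:
  fixes p :: "nat \<Rightarrow> nat \<Rightarrow> complex"
  assumes herm: "\<And>i k. i < n \<Longrightarrow> k < n \<Longrightarrow> p i k = cnj (p k i)"
    and pos: "\<And>v. (\<exists>i<n. v i \<noteq> 0) \<Longrightarrow> 0 < mat_form n p v"
  shows "\<exists>s. \<forall>a<n. \<forall>b<n. (\<Sum>i<n. \<Sum>k<n. p i k * s a k * cnj (s b i)) = of_bool (a = b)"
proof -
  define \<beta> where "\<beta> u w = (\<Sum>i<n. \<Sum>k<n. p i k * u k * cnj (w i))" for u w :: "nat \<Rightarrow> complex"
  have \<beta>_add: "\<beta> (\<lambda>i. u i + c * u' i) w = \<beta> u w + c * \<beta> u' w" for u u' w c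
    by (simp add: \<beta>_def distrib_left distrib_right sum.distrib sum_distrib_left mult_ac)
  have \<beta>_sum: "\<beta> (\<lambda>i. \<Sum>a\<in>I. c a * g a i) w = (\<Sum>a\<in>I. c a * \<beta> (g a) w)" if "finite I"
    for I :: "nat set" and c g w
    using that
  proof (induction I rule: finite_induct)
    case empty
    then show ?case
      by (simp add: \<beta>_def)
  next
    case (insert x I)
    then show ?case
      using \<beta>_add[of "\<lambda>i. \<Sum>a\<in>I. c a * g a i" "c x" "g x" w] by (simp add: add.commute)
  qed
  have \<beta>_cnj: "\<beta> w u = cnj (\<beta> u w)" for u w
  proof -
    have "cnj (\<beta> u w) = (\<Sum>i<n. \<Sum>k<n. cnj (p i k) * cnj (u k) * w i)"
      by (simp add: \<beta>_def)
    also have "\<dots> = (\<Sum>k<n. \<Sum>i<n. cnj (p i k) * cnj (u k) * w i)"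
      by (rule sum.swap)
    also have "\<dots> = \<beta> w u"
      unfolding \<beta>_def
    proof (intro sum.cong refl)
      fix k i assume "k \<in> {..<n}" "i \<in> {..<n}"
      then show "cnj (p i k) * cnj (u k) * w i = p k i * w i * cnj (u k)"
        using herm[of k i] by simp
    qed
    finally show ?thesis ..
  qed
  have "\<exists>s. (\<forall>a<m. \<forall>i>a. s a i = 0) \<and> (\<forall>a<m. \<forall>b<m. \<beta> (s a) (s b) = of_bool (a = b))" if "m \<le> n" for m
    using that
  proof (induction m)
    case 0
    then show ?case
      by simp
  next
    case (Suc m)
    then obtain s where s: "\<forall>a<m. \<forall>i>a. s a i = 0" "\<forall>a<m. \<forall>b<m. \<beta> (s a) (s b) = of_bool (a = b)"
      using Suc_leD by blast
    have tri: "s a i = 0" if "a < m" "a < i" for a i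
      using s(1) that by blast
    have orth: "\<beta> (s a) (s b) = of_bool (a = b)" if "a < m" "b < m" for a b
      using s(2) that by blast
    define \<epsilon> where "\<epsilon> i = (of_bool (i = m) :: complex)" for i
    \<comment> \<open>The unit vector \<open>m\<close> minus its projection on the earlier vectors;
      \<open>(- 1) *\<close> is written out to match the shape of
      \<open>\<beta>_add\<close>.\<close>
    define u where "u i = \<epsilon> i + (- 1) * (\<Sum>a\<in>{..<m}. \<beta> \<epsilon> (s a) * s a i)" for i
    have u_orth: "\<beta> u (s b) = 0" if "b < m" for b
    proof -
      have "\<beta> u (s b) = \<beta> \<epsilon> (s b) + (- 1) * (\<Sum>a\<in>{..<m}. \<beta> \<epsilon> (s a) * \<beta> (s a) (s b))"
        unfolding u_def \<beta>_add by (simp add: \<beta>_sum)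
      also have "(\<Sum>a\<in>{..<m}. \<beta> \<epsilon> (s a) * \<beta> (s a) (s b)) = (\<Sum>a\<in>{..<m}. if a = b then \<beta> \<epsilon> (s a) else 0)"
        by (intro sum.cong refl) (auto simp: orth that)
      finally show ?thesis
        using that by simp
    qed
    have u_tri: "u i = 0" if "m < i" for i
      using that by (simp add: u_def \<epsilon>_def tri)
    have "u m = 1"
      by (simp add: u_def \<epsilon>_def tri)
    then have "\<exists>i<n. u i \<noteq> 0"
      using Suc.prems by (intro exI[of _ m]) simp
    then have "0 < \<beta> u u"
      using pos[of u] by (simp add: \<beta>_def mat_form_def)
    then have u_norm: "\<beta> u u = complex_of_real (Re (\<beta> u u))" "0 < Re (\<beta> u u)"
      by (auto simp: less_complex_def complex_eq_iff)
    define q where "q = complex_of_real (1 / sqrt (Re (\<beta> u u)))"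
    have q_real: "cnj q = q"
      by (simp add: q_def)
    have scale: "\<beta> (\<lambda>i. q * u i) w = q * \<beta> u w" for w
      by (simp add: \<beta>_def sum_distrib_left mult_ac)
    have scale': "\<beta> w (\<lambda>i. q * u i) = q * \<beta> w u" for w
      using \<beta>_cnj[of w "\<lambda>i. q * u i"] \<beta>_cnj[of w u] by (simp only: scale complex_cnj_mult q_real)
    have "q * (q * \<beta> u u) = complex_of_real (1 / sqrt (Re (\<beta> u u)) * (1 / sqrt (Re (\<beta> u u)) * Re (\<beta> u u)))"
      by (subst u_norm(1)) (simp only: q_def of_real_mult)
    also have "\<dots> = 1"
      using u_norm(2) by (simp add: field_simps)
    finally have unit: "q * (q * \<beta> u u) = 1" .
    have su: "\<beta> (s b) u = 0" if "b < m" for b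
      by (subst \<beta>_cnj) (simp add: u_orth that)
    have "(\<forall>a<Suc m. \<forall>i>a. (s(m := \<lambda>i. q * u i)) a i = 0) \<and>
      (\<forall>a<Suc m. \<forall>b<Suc m. \<beta> ((s(m := \<lambda>i. q * u i)) a) ((s(m := \<lambda>i. q * u i)) b) = of_bool (a = b))"
      by (auto simp: less_Suc_eq tri orth u_orth su scale scale' unit u_tri)
    then show ?case
      by blast
  qed
  from this[of n] show ?thesis
    unfolding \<beta>_def by blast
qed

section \<open>Normalizing a positive pencil\<close>

text \<open>Let S have entry \<open>s a k\<close> in row \<open>k\<close> and column
  \<open>a\<close>, and let Q be the adjoint of S times \<open>p\<close>. Gram-Schmidt says Q S = I,
  so S Q = I as the matrices are square; since \<open>p\<close> is Hermitian, the adjoint of Q is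
  \<open>p\<close> S, and multiplied by Q it gives \<open>p\<close>.\<close>

lemma form_factorization:
  fixes p :: "nat \<Rightarrow> nat \<Rightarrow> complex"
  assumes herm: "\<And>i k. i < n \<Longrightarrow> k < n \<Longrightarrow> p i k = cnj (p k i)"
    and pos: "\<And>v. (\<exists>i<n. v i \<noteq> 0) \<Longrightarrow> 0 < mat_form n p v"
  obtains s q where
    "\<And>a b. a < n \<Longrightarrow> b < n \<Longrightarrow> (\<Sum>i<n. \<Sum>k<n. p i k * s a k * cnj (s b i)) = of_bool (a = b)"
    and "\<And>k t. k < n \<Longrightarrow> t < n \<Longrightarrow> (\<Sum>a<n. s a k * q a t) = of_bool (k = t)"
    and "\<And>u t. u < n \<Longrightarrow> t < n \<Longrightarrow> (\<Sum>a<n. q a t * cnj (q a u)) = p u t"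
proof -
  obtain s where s: "\<And>a b. a < n \<Longrightarrow> b < n \<Longrightarrow>
      (\<Sum>i<n. \<Sum>k<n. p i k * s a k * cnj (s b i)) = of_bool (a = b)"
    using gram_schmidt_form[of n p] herm pos by blast
  define q where "q a t = (\<Sum>i<n. cnj (s a i) * p i t)" for a t
  let ?Q = "mat n n (\<lambda>(a, t). q a t)" and ?S = "mat n n (\<lambda>(k, a). s a k)"
  have "?Q * ?S = 1\<^sub>m n"
  proof (rule eq_matI)
    fix b a assume "b < dim_row (1\<^sub>m n)" "a < dim_col (1\<^sub>m n)"
    then have ab: "b < n" "a < n"
      by simp_all
    have "(?Q * ?S) $$ (b, a) = (\<Sum>k<n. \<Sum>i<n. p i k * s a k * cnj (s b i))"
      using ab by (simp add: scalar_prod_def q_def sum_distrib_left lessThan_atLeast0 mult_ac)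
    also have "\<dots> = (\<Sum>i<n. \<Sum>k<n. p i k * s a k * cnj (s b i))"
      by (rule sum.swap)
    finally show "(?Q * ?S) $$ (b, a) = 1\<^sub>m n $$ (b, a)"
      using ab by (simp add: s)
  qed simp_all
  then have SQ: "?S * ?Q = 1\<^sub>m n"
    by (rule mat_mult_left_right_inverse[rotated 2]) simp_all
  have inv: "(\<Sum>a<n. s a k * q a t) = of_bool (k = t)" if "k < n" "t < n" for k t
  proof -
    have "(?S * ?Q) $$ (k, t) = (\<Sum>a<n. s a k * q a t)"
      using that by (simp add: scalar_prod_def lessThan_atLeast0)
    then show ?thesis
      using that unfolding SQ by auto
  qed
  have "(\<Sum>a<n. q a t * cnj (q a u)) = p u t" if "u < n" "t < n" for u t
  proof -
    have "(\<Sum>a<n. q a t * cnj (q a u)) = (\<Sum>a<n. \<Sum>i<n. p u i * (s a i * q a t))"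
    proof (rule sum.cong)
      fix a
      have "cnj (q a u) = (\<Sum>i<n. p u i * s a i)"
        unfolding q_def cnj_sum
      proof (rule sum.cong)
        fix i assume "i \<in> {..<n}"
        then show "cnj (cnj (s a i) * p i u) = p u i * s a i"
          using herm[of u i] \<open>u < n\<close> by simp
      qed simp
      then show "q a t * cnj (q a u) = (\<Sum>i<n. p u i * (s a i * q a t))"
        by (simp add: sum_distrib_left mult_ac)
    qed simp
    also have "\<dots> = (\<Sum>i<n. p u i * (\<Sum>a<n. s a i * q a t))"
      by (subst sum.swap) (simp add: sum_distrib_left)
    also have "\<dots> = (\<Sum>i<n. if i = t then p u i else 0)"
      by (intro sum.cong refl) (simp add: inv that)
    finally show ?thesis
      using that by simp
  qed
  with s inv show thesis
    by (rule that)
qed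

text \<open>The substitution of \<open>\<Sum>a<n. s a k *\<^sub>C y a\<close> for the
  \<open>k\<close>-th vector replaces the coefficient matrix \<open>c\<close> by its congruence
  under \<open>s\<close>.\<close>

lemma cinner_congruence:
  assumes T: "T \<in> bounded_ops"
  shows "(\<Sum>i<n. \<Sum>k<n. c i k * cinner (blinfun_apply T (\<Sum>a<n. s a k *\<^sub>C y a)) (\<Sum>b<n. s b i *\<^sub>C y b)) =
    (\<Sum>b<n. \<Sum>a<n. (\<Sum>i<n. \<Sum>k<n. c i k * s a k * cnj (s b i)) * cinner (T (y a)) (y b))"
proof -
  let ?h = "\<lambda>i k b a. c i k * s a k * cnj (s b i) * cinner (blinfun_apply T (y a)) (y b)"
  have "c i k * cinner (blinfun_apply T (\<Sum>a<n. s a k *\<^sub>C y a)) (\<Sum>b<n. s b i *\<^sub>C y b) =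
      (\<Sum>b<n. \<Sum>a<n. ?h i k b a)" for i k
    by (simp add: blinfun.sum_right bounded_ops_scaleC[OF T] cinner_sum_left cinner_sum_right
        cinner_scaleC_left cinner_scaleC_right sum_distrib_left mult_ac)
  then have "(\<Sum>i<n. \<Sum>k<n. c i k * cinner (blinfun_apply T (\<Sum>a<n. s a k *\<^sub>C y a)) (\<Sum>b<n. s b i *\<^sub>C y b)) =
      (\<Sum>i<n. \<Sum>k<n. \<Sum>b<n. \<Sum>a<n. ?h i k b a)"
    by simp
  also have "\<dots> = (\<Sum>i<n. \<Sum>b<n. \<Sum>k<n. \<Sum>a<n. ?h i k b a)"
    by (intro sum.cong refl sum.swap)
  also have "\<dots> = (\<Sum>b<n. \<Sum>i<n. \<Sum>k<n. \<Sum>a<n. ?h i k b a)"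
    by (rule sum.swap)
  also have "\<dots> = (\<Sum>b<n. \<Sum>i<n. \<Sum>a<n. \<Sum>k<n. ?h i k b a)"
    by (intro sum.cong refl sum.swap)
  also have "\<dots> = (\<Sum>b<n. \<Sum>a<n. \<Sum>i<n. \<Sum>k<n. ?h i k b a)"
    by (intro sum.cong refl sum.swap)
  finally show ?thesis
    by (simp add: sum_distrib_right)
qed

text \<open>Pairing at the vector \<open>q\<close>, the inverse of \<open>s\<close>, undoes the
  congruence: once the sums over \<open>a\<close> and \<open>b\<close> are moved inside, they
  collapse to Kronecker deltas.\<close>

lemma coefficient_congruence:
  fixes s q :: "nat \<Rightarrow> nat \<Rightarrow> complex"
  assumes inv: "\<And>k t. k < n \<Longrightarrow> t < n \<Longrightarrow> (\<Sum>a<n. s a k * q a t) = of_bool (k = t)"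
  shows "(\<Sum>b<n. \<Sum>a<n. \<Sum>u<n. \<Sum>t<n.
      (\<Sum>i<n. \<Sum>k<n. c i k * s a k * cnj (s b i)) * x u t * q a t * cnj (q b u)) =
    (\<Sum>u<n. \<Sum>t<n. c u t * x u t)"
proof -
  let ?h = "\<lambda>b a u t i k. x u t * (c i k * (s a k * q a t) * cnj (s b i * q b u))"
  have "(\<Sum>b<n. \<Sum>a<n. \<Sum>u<n. \<Sum>t<n.
      (\<Sum>i<n. \<Sum>k<n. c i k * s a k * cnj (s b i)) * x u t * q a t * cnj (q b u)) =
      (\<Sum>b<n. \<Sum>a<n. \<Sum>u<n. \<Sum>t<n. \<Sum>i<n. \<Sum>k<n. ?h b a u t i k)"
    by (simp add: sum_distrib_right sum_distrib_left mult_ac)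
  also have "\<dots> = (\<Sum>b<n. \<Sum>u<n. \<Sum>a<n. \<Sum>t<n. \<Sum>i<n. \<Sum>k<n. ?h b a u t i k)"
    by (intro sum.cong refl sum.swap)
  also have "\<dots> = (\<Sum>u<n. \<Sum>b<n. \<Sum>a<n. \<Sum>t<n. \<Sum>i<n. \<Sum>k<n. ?h b a u t i k)"
    by (rule sum.swap)
  also have "\<dots> = (\<Sum>u<n. \<Sum>b<n. \<Sum>t<n. \<Sum>a<n. \<Sum>i<n. \<Sum>k<n. ?h b a u t i k)"
    by (intro sum.cong refl sum.swap)
  also have "\<dots> = (\<Sum>u<n. \<Sum>t<n. \<Sum>b<n. \<Sum>a<n. \<Sum>i<n. \<Sum>k<n. ?h b a u t i k)"
    by (intro sum.cong refl sum.swap)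
  also have "\<dots> = (\<Sum>u<n. \<Sum>t<n. c u t * x u t)"
  proof (intro sum.cong refl)
    fix u t assume ut: "u \<in> {..<n}" "t \<in> {..<n}"
    have "(\<Sum>b<n. \<Sum>a<n. \<Sum>i<n. \<Sum>k<n. ?h b a u t i k) = (\<Sum>b<n. \<Sum>i<n. \<Sum>a<n. \<Sum>k<n. ?h b a u t i k)"
      by (intro sum.cong refl sum.swap)
    also have "\<dots> = (\<Sum>i<n. \<Sum>b<n. \<Sum>a<n. \<Sum>k<n. ?h b a u t i k)"
      by (rule sum.swap)
    also have "\<dots> = (\<Sum>i<n. \<Sum>b<n. \<Sum>k<n. \<Sum>a<n. ?h b a u t i k)"
      by (intro sum.cong refl sum.swap)
    also have "\<dots> = (\<Sum>i<n. \<Sum>k<n. \<Sum>b<n. \<Sum>a<n. ?h b a u t i k)"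
      by (intro sum.cong refl sum.swap)
    also have "\<dots> = (\<Sum>i<n. \<Sum>k<n. \<Sum>a<n. \<Sum>b<n. ?h b a u t i k)"
      by (intro sum.cong refl sum.swap)
    also have "\<dots> = (\<Sum>i<n. \<Sum>k<n. x u t * (c i k * (\<Sum>a<n. s a k * q a t) * cnj (\<Sum>b<n. s b i * q b u)))"
      by (simp add: sum_distrib_right sum_distrib_left mult_ac)
    also have "\<dots> = (\<Sum>i<n. \<Sum>k<n. if k = t then (if i = u then x u t * c i k else 0) else 0)"
      by (intro sum.cong refl) (use ut in \<open>simp add: inv\<close>)
    also have "\<dots> = c u t * x u t"
      using ut by simp
    finally show "(\<Sum>b<n. \<Sum>a<n. \<Sum>i<n. \<Sum>k<n. ?h b a u t i k) = c u t * x u t" .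
  qed
  finally show ?thesis .
qed

lemma mat_form_real:
  assumes "\<And>i k. i < n \<Longrightarrow> k < n \<Longrightarrow> p i k = cnj (p k i)"
  shows "Im (mat_form n p v) = 0"
proof -
  have "cnj (mat_form n p v) = (\<Sum>k<n. \<Sum>l<n. cnj (p k l) * cnj (v l) * v k)"
    by (simp add: mat_form_def)
  also have "\<dots> = (\<Sum>l<n. \<Sum>k<n. cnj (p k l) * cnj (v l) * v k)"
    by (rule sum.swap)
  also have "\<dots> = mat_form n p v"
    unfolding mat_form_def
  proof (intro sum.cong refl)
    fix l k assume "l \<in> {..<n}" "k \<in> {..<n}"
    then show "cnj (p k l) * cnj (v l) * v k = p l k * v k * cnj (v l)"
      using assms[of l k] by simp
  qed
  finally show ?thesis
    by (simp add: complex_eq_iff)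
qed

text \<open>A completely positive map that kills the coefficients \<open>A j\<close> leaves only the constant term.\<close>

lemma pencil_constant_term_positive:
  assumes A: "\<forall>j. A j \<in> bounded_ops"
    and zero: "(\<lambda>j. 0\<^sub>m l l) \<in> matrix_range_level l A" "1 \<le> l"
    and pos: "\<And>x. 0 \<le> Re (op_form n (pencil P L A) x)"
  shows "0 \<le> Re (mat_form n P w)"
proof -
  obtain \<phi> where \<phi>: "ucp_map (cstar_generated A) l \<phi>" and "(\<lambda>j. 0\<^sub>m l l) = (\<lambda>j. \<phi> (A j))"
    using zero(1) by (auto simp: matrix_range_level_def)
  then have \<phi>_zero: "(\<lambda>j. \<phi> (A j)) = (\<lambda>j. 0\<^sub>m l l)"
    by simp
  \<comment> \<open>The tensor product of \<open>w\<close> with the unit vector 0, which exists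
    because \<open>1 \<le> l\<close>.\<close>
  let ?v = "\<lambda>i s. w i * of_bool (s = 0)"
  have "0 \<le> Re (block_form n l (block_pencil P L (\<lambda>j. \<phi> (A j))) ?v)"
    by (intro ucp_pencil_positive[OF unital_cstar_subalgebra_cstar_generated(1)[OF A] \<phi>]
        unital_cstar_subalgebra_cstar_generated(2)[OF A] pos)
  also have "block_form n l (block_pencil P L (\<lambda>j. \<phi> (A j))) ?v =
      (\<Sum>i<n. \<Sum>k<n. \<Sum>s<l. if s = 0 then P i k * w k * cnj (w i) else 0)"
    unfolding \<phi>_zero block_form_pencil by (simp add: of_bool_def if_distrib cong: if_cong)
  also have "\<dots> = mat_form n P w"
    using zero(2) by (simp add: mat_form_def)
  finally show ?thesis .
qed

text \<open>A congruence turns the constant term of the positive pencil into the identity, so the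
  other coefficients yield a point of the free spectrahedron at which the polar inequality can be
  tested. The flag \<open>sa\<close> treats both settings at once: when it holds, the inequality is
  given for self-adjoint \<open>Y\<close> only, and Hermitian \<open>L\<close> makes
  \<open>Y\<close> self-adjoint.\<close>

lemma polar_pairing_nonneg:
  fixes A :: "'d::finite \<Rightarrow> 'h::chilbert_space \<Rightarrow>\<^sub>L 'h"
  assumes A: "\<forall>j. A j \<in> bounded_ops"
    and zero: "(\<lambda>j. 0\<^sub>m l l) \<in> matrix_range_level l A" "1 \<le> l"
    and n: "1 \<le> n"
    and polar: "\<And>Y. Y \<in> mat_tuples n \<Longrightarrow> Y \<in> free_spectrahedron A \<Longrightarrow>
      (sa \<Longrightarrow> Y \<in> sa_mat_tuples n) \<Longrightarrow> mat_le (n * n) (mat_Re (kron_sum n n Y X)) (1\<^sub>m (n * n))"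
    and P: "\<And>i k. i < n \<Longrightarrow> k < n \<Longrightarrow> P i k = cnj (P k i)"
    and L: "\<And>j i k. sa \<Longrightarrow> i < n \<Longrightarrow> k < n \<Longrightarrow> L j i k = cnj (L j k i)"
    and pos: "\<And>x. 0 \<le> Re (op_form n (pencil P L A) x)"
  shows "0 \<le> Re (\<Sum>i<n. P i i) + Re (\<Sum>j\<in>UNIV. \<Sum>i<n. \<Sum>k<n. L j i k * X j $$ (i, k))"
proof (rule field_le_epsilon)
  fix e :: real assume "0 < e"
  \<comment> \<open>Adding \<epsilon> times the identity makes the positive semidefinite
    \<open>P\<close> definite and raises its trace by exactly \<open>e\<close>.\<close>
  define \<epsilon> where "\<epsilon> = e / real n"
  have \<epsilon>: "0 < \<epsilon>" "real n * \<epsilon> = e"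
    using \<open>0 < e\<close> n by (simp_all add: \<epsilon>_def)
  define p where "p i k = P i k + complex_of_real \<epsilon> * of_bool (i = k)" for i k
  have p_sum: "(\<Sum>i<n. \<Sum>k<n. p i k * g i k) = (\<Sum>i<n. \<Sum>k<n. P i k * g i k) + complex_of_real \<epsilon> * (\<Sum>i<n. g i i)"
    for g :: "nat \<Rightarrow> nat \<Rightarrow> complex"
  proof -
    have "(\<Sum>i<n. \<Sum>k<n. p i k * g i k) = (\<Sum>i<n. \<Sum>k<n. P i k * g i k) +
        (\<Sum>i<n. \<Sum>k<n. if k = i then complex_of_real \<epsilon> * g i k else 0)"
      unfolding sum.distrib[symmetric] by (intro sum.cong refl) (simp add: p_def distrib_right)
    then show ?thesis
      by (simp add: sum_distrib_left)
  qed
  have p_herm: "p i k = cnj (p k i)" if "i < n" "k < n" for i k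
    using P[OF that] by (simp add: p_def)
  have p_pos: "0 < mat_form n p v" if "\<exists>i<n. v i \<noteq> 0" for v
  proof -
    have "0 < (\<Sum>i<n. (cmod (v i))\<^sup>2)"
      using that by (auto intro: sum_pos2)
    moreover have "mat_form n p v = mat_form n P v +
        complex_of_real \<epsilon> * complex_of_real (\<Sum>i<n. (cmod (v i))\<^sup>2)"
      using p_sum[of "\<lambda>i k. v k * cnj (v i)"]
      by (simp add: mat_form_def mult.assoc flip: complex_norm_square)
    moreover have "0 \<le> Re (mat_form n P v)"
      by (rule pencil_constant_term_positive[OF A zero pos])
    ultimately have "0 < Re (mat_form n p v)"
      using \<epsilon>(1) by (simp add: add_nonneg_pos flip: of_real_mult)
    moreover have "Im (mat_form n p v) = 0"
      by (intro mat_form_real p_herm)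
    ultimately show ?thesis
      by (simp add: less_complex_def)
  qed
  obtain s q where gram: "\<And>a b. a < n \<Longrightarrow> b < n \<Longrightarrow>
      (\<Sum>i<n. \<Sum>k<n. p i k * s a k * cnj (s b i)) = of_bool (a = b)"
    and inv: "\<And>k t. k < n \<Longrightarrow> t < n \<Longrightarrow> (\<Sum>a<n. s a k * q a t) = of_bool (k = t)"
    and q: "\<And>u t. u < n \<Longrightarrow> t < n \<Longrightarrow> (\<Sum>a<n. q a t * cnj (q a u)) = p u t"
    using form_factorization[of n p, OF p_herm p_pos] by blast
  \<comment> \<open>\<open>M j\<close> is the congruence of \<open>L j\<close> by \<open>s\<close>.
    The sign in \<open>Y\<close> offsets the minus sign with which \<open>Y\<close> enters the
    pencil of the free spectrahedron.\<close>
  define M where "M j b a = (\<Sum>i<n. \<Sum>k<n. L j i k * s a k * cnj (s b i))" for j b a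
  define Y where "Y j = mat n n (\<lambda>(b, a). - M j b a)" for j
  have Y_tuples: "Y \<in> mat_tuples n"
    by (simp add: mat_tuples_def Y_def)
  have "0 \<le> Re (op_form n (pencil (\<lambda>i k. of_bool (i = k)) (\<lambda>j i k. - Y j $$ (i, k)) A) y)" for y
  proof -
    \<comment> \<open>The form of the normalized pencil at \<open>y\<close> is the form of the
      original one at \<open>x\<close>, plus \<epsilon> times the squared norm of
      \<open>x\<close>.\<close>
    define x where "x k = (\<Sum>a<n. s a k *\<^sub>C y a)" for k
    have "op_form n (pencil (\<lambda>i k. of_bool (i = k)) (\<lambda>j i k. - Y j $$ (i, k)) A) y =
        (\<Sum>b<n. \<Sum>a<n. (\<Sum>i<n. \<Sum>k<n. p i k * s a k * cnj (s b i)) * cinner (y a) (y b)) +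
        (\<Sum>j\<in>UNIV. \<Sum>b<n. \<Sum>a<n. M j b a * cinner (A j (y a)) (y b))"
      unfolding op_form_pencil
      by (intro arg_cong2[where f = "(+)"] sum.cong refl) (auto simp: gram Y_def)
    also have "(\<Sum>b<n. \<Sum>a<n. (\<Sum>i<n. \<Sum>k<n. p i k * s a k * cnj (s b i)) * cinner (y a) (y b)) =
        (\<Sum>i<n. \<Sum>k<n. p i k * cinner (x k) (x i))"
      using cinner_congruence[OF cstar_id[OF unital_cstar_subalgebra_bounded_ops],
          where n = n and c = p and s = s and y = y]
      by (simp add: x_def)
    also have "(\<Sum>j\<in>UNIV. \<Sum>b<n. \<Sum>a<n. M j b a * cinner (A j (y a)) (y b)) =
        (\<Sum>j\<in>UNIV. \<Sum>i<n. \<Sum>k<n. L j i k * cinner (A j (x k)) (x i))"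
      unfolding M_def x_def using A by (simp add: cinner_congruence)
    also have "(\<Sum>i<n. \<Sum>k<n. p i k * cinner (x k) (x i)) =
        (\<Sum>i<n. \<Sum>k<n. P i k * cinner (x k) (x i)) + complex_of_real \<epsilon> * (\<Sum>i<n. cinner (x i) (x i))"
      by (rule p_sum)
    finally have "Re (op_form n (pencil (\<lambda>i k. of_bool (i = k)) (\<lambda>j i k. - Y j $$ (i, k)) A) y) =
        Re (op_form n (pencil P L A) x) + \<epsilon> * (\<Sum>i<n. (norm (x i))\<^sup>2)"
      unfolding op_form_pencil by (simp add: cinner_self)
    then show ?thesis
      using pos[of x] \<epsilon>(1) by (simp add: sum_nonneg)
  qed
  then have "Y \<in> free_spectrahedron A"
    using free_spectrahedron_iff[OF _ Y_tuples n] A by blast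
  moreover have "Y \<in> sa_mat_tuples n" if sa
  proof -
    have "cnj (M j a b) = M j b a" for j a b
    proof -
      have "cnj (M j a b) = (\<Sum>i<n. \<Sum>k<n. cnj (L j i k) * cnj (s b k) * s a i)"
        by (simp add: M_def)
      also have "\<dots> = (\<Sum>k<n. \<Sum>i<n. cnj (L j i k) * cnj (s b k) * s a i)"
        by (rule sum.swap)
      also have "\<dots> = M j b a"
        unfolding M_def
      proof (intro sum.cong refl)
        fix k i assume "k \<in> {..<n}" "i \<in> {..<n}"
        then show "cnj (L j i k) * cnj (s b k) * s a i = L j k i * s a i * cnj (s b k)"
          using L[OF that, of k i j] by simp
      qed
      finally show ?thesis .
    qed
    then have "mat_adjoint (Y j) = Y j" for j
      using mat_adjoint_eq_iff[of "Y j" n "Y j"] by (simp add: Y_def)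
    then show ?thesis
      using Y_tuples by (simp add: sa_mat_tuples_def)
  qed
  ultimately have "mat_le (n * n) (mat_Re (kron_sum n n Y X)) (1\<^sub>m (n * n))"
    using polar Y_tuples by blast
  \<comment> \<open>At the vector \<open>q\<close> the constant term contributes the trace of
    \<open>p\<close>, and the congruence hidden in \<open>Y\<close> cancels.\<close>
  then have "0 \<le> Re (block_form n n (block_pencil (\<lambda>i k. of_bool (i = k)) (\<lambda>j i k. - Y j $$ (i, k)) X) q)"
    unfolding polar_condition_iff by blast
  also have "block_form n n (block_pencil (\<lambda>i k. of_bool (i = k)) (\<lambda>j i k. - Y j $$ (i, k)) X) q =
      (\<Sum>i<n. p i i) + (\<Sum>j\<in>UNIV. \<Sum>i<n. \<Sum>k<n. L j i k * X j $$ (i, k))"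
  proof -
    have "(\<Sum>i<n. \<Sum>k<n. \<Sum>s<n. of_bool (i = k) * q k s * cnj (q i s)) =
        (\<Sum>i<n. \<Sum>k<n. if k = i then \<Sum>s<n. q k s * cnj (q i s) else 0)"
      by (intro sum.cong refl) auto
    also have "\<dots> = (\<Sum>i<n. \<Sum>s<n. q i s * cnj (q i s))"
      by simp
    also have "\<dots> = (\<Sum>s<n. \<Sum>i<n. q i s * cnj (q i s))"
      by (rule sum.swap)
    also have "\<dots> = (\<Sum>i<n. p i i)"
      by (simp add: q)
    finally have 1: "(\<Sum>i<n. \<Sum>k<n. \<Sum>s<n. of_bool (i = k) * q k s * cnj (q i s)) = (\<Sum>i<n. p i i)" .
    have 2: "(\<Sum>b<n. \<Sum>a<n. \<Sum>u<n. \<Sum>t<n. - Y j $$ (b, a) * X j $$ (u, t) * q a t * cnj (q b u)) =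
        (\<Sum>i<n. \<Sum>k<n. L j i k * X j $$ (i, k))" for j
      using coefficient_congruence[where c = "L j" and x = "\<lambda>u t. X j $$ (u, t)", OF inv]
      by (simp add: Y_def M_def)
    show ?thesis
      unfolding block_form_pencil 1 2 ..
  qed
  also have "(\<Sum>i<n. p i i) = (\<Sum>i<n. P i i) + complex_of_real e"
    by (simp add: p_def sum.distrib \<epsilon>(2)[symmetric])
  finally show "0 \<le> Re (\<Sum>i<n. P i i) + Re (\<Sum>j\<in>UNIV. \<Sum>i<n. \<Sum>k<n. L j i k * X j $$ (i, k)) + e"
    by simp
qed

section \<open>The matrix range as a polar dual\<close>

text \<open>
  The completely positive maps into the \<open>n\<close>-by-\<open>n\<close> matrices, as functions of an operator and a
  matrix position. The norm bound, which positivity would imply on \<open>bounded_ops\<close> up to a constant,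
  also controls the irrelevant values at the other real-linear maps.
\<close>

definition cp_cone :: "nat \<Rightarrow> (('h::chilbert_space \<Rightarrow>\<^sub>L 'h) \<times> nat \<times> nat \<Rightarrow> complex) set"
  where "cp_cone n = {\<theta>.
    (\<forall>S T i k. \<theta> (S + T, i, k) = \<theta> (S, i, k) + \<theta> (T, i, k)) \<and>
    (\<forall>c T i k. \<theta> (op_scale c T, i, k) = c * \<theta> (T, i, k)) \<and>
    (\<forall>m M v. (\<forall>i k. M i k \<in> bounded_ops) \<and> (\<forall>x. 0 \<le> op_form m M x) \<longrightarrow>
      0 \<le> block_form m n (\<lambda>i k s t. \<theta> (M i k, s, t)) v) \<and>
    (\<forall>T i k. cmod (\<theta> (T, i, k)) \<le> norm T * Re (\<Sum>s<n. \<theta> (id_blinfun, s, s)))}"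

text \<open>For fixed operators, indices and vectors each condition involves finitely many
  coordinates of \<theta>, hence is closed in the product topology. The positivity premise does not
  mention \<theta>.\<close>

lemma closed_cp_cone: "closed (cp_cone n)"
proof -
  have cont: "continuous_on UNIV (\<lambda>\<theta> :: 'b \<Rightarrow> complex. \<theta> b)" for b :: 'b
    by simp
  have "closed {\<theta> :: ('a \<Rightarrow>\<^sub>L 'a) \<times> nat \<times> nat \<Rightarrow> complex.
      (\<forall>i k. M i k \<in> bounded_ops) \<and> (\<forall>x. 0 \<le> op_form m M x) \<longrightarrow>
      0 \<le> block_form m n (\<lambda>i k s t. \<theta> (M i k, s, t)) v}" for m M v
  proof -
    have "closed {\<theta> :: ('a \<Rightarrow>\<^sub>L 'a) \<times> nat \<times> nat \<Rightarrow> complex.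
        0 \<le> block_form m n (\<lambda>i k s t. \<theta> (M i k, s, t)) v}"
      unfolding complex_nonneg_iff block_form_def
      by (intro closed_Collect_conj closed_Collect_le closed_Collect_eq continuous_intros cont)
    then show ?thesis
      by (intro closed_Collect_imp open_Collect_const)
  qed
  then show ?thesis
    unfolding cp_cone_def
    by (intro closed_Collect_conj closed_Collect_all)
      (auto intro!: closed_Collect_eq closed_Collect_le continuous_intros cont)
qed

lemma zero_in_cp_cone: "(\<lambda>_. 0) \<in> cp_cone n"
  by (simp add: cp_cone_def block_form_def)

lemma add_in_cp_cone:
  assumes "\<theta> \<in> cp_cone n" "\<eta> \<in> cp_cone n"
  shows "(\<lambda>b. \<theta> b + \<eta> b) \<in> cp_cone n"
proof -
  have form: "block_form m n (\<lambda>i k s t. \<theta> (M i k, s, t) + \<eta> (M i k, s, t)) v =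
    block_form m n (\<lambda>i k s t. \<theta> (M i k, s, t)) v + block_form m n (\<lambda>i k s t. \<eta> (M i k, s, t)) v" for m M v
    by (simp add: block_form_def distrib_right sum.distrib)
  have "cmod (\<theta> (T, i, k) + \<eta> (T, i, k)) \<le>
      norm T * Re (\<Sum>s<n. \<theta> (id_blinfun, s, s) + \<eta> (id_blinfun, s, s))" for T i k
  proof -
    have "cmod (\<theta> (T, i, k)) \<le> norm T * Re (\<Sum>s<n. \<theta> (id_blinfun, s, s))"
      "cmod (\<eta> (T, i, k)) \<le> norm T * Re (\<Sum>s<n. \<eta> (id_blinfun, s, s))"
      using assms by (simp_all add: cp_cone_def)
    then show ?thesis
      using norm_triangle_ineq[of "\<theta> (T, i, k)" "\<eta> (T, i, k)"]
      by (simp add: sum.distrib distrib_left)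
  qed
  then show ?thesis
    using assms unfolding cp_cone_def by (simp add: form distrib_left)
qed

lemma scale_in_cp_cone:
  assumes "\<theta> \<in> cp_cone n" "0 \<le> t"
  shows "(\<lambda>b. complex_of_real t * \<theta> b) \<in> cp_cone n"
proof -
  have form: "block_form m n (\<lambda>i k s u. complex_of_real t * \<theta> (M i k, s, u)) v =
    complex_of_real t * block_form m n (\<lambda>i k s u. \<theta> (M i k, s, u)) v" for m M v
    by (simp add: block_form_def sum_distrib_left mult.assoc)
  have "cmod (complex_of_real t * \<theta> (T, i, k)) \<le>
      norm T * Re (\<Sum>s<n. complex_of_real t * \<theta> (id_blinfun, s, s))" for T i k
  proof -
    have "t * cmod (\<theta> (T, i, k)) \<le> t * (norm T * Re (\<Sum>s<n. \<theta> (id_blinfun, s, s)))"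
      using assms by (intro mult_left_mono) (simp_all add: cp_cone_def)
    then show ?thesis
      using assms(2) by (simp add: norm_mult sum_distrib_left mult_ac)
  qed
  then show ?thesis
    using assms unfolding cp_cone_def by (simp add: form distrib_left complex_nonneg_iff)
qed

text \<open>The compression of \<open>T\<close> by the map from \<complex>^n to H that sends unit
  vector \<open>k\<close> to \<open>x k\<close>. These elements of the cone recover the form of a
  pencil at \<open>x\<close> from the separating functional. Positions outside the \<open>n\<close>
  by \<open>n\<close> square get 0 because the norm bound in \<open>cp_cone\<close> ranges over all
  positions.\<close>

lemma compression_in_cp_cone:
  "(\<lambda>(T, i, k). if i < n \<and> k < n then cinner (blinfun_apply T (x k)) (x i) else 0) \<in> cp_cone n"
  (is "?\<theta> \<in> _")
proof -
  have "0 \<le> block_form m n (\<lambda>i k s t. ?\<theta> (M i k, s, t)) v"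
    if M: "\<And>i k. M i k \<in> bounded_ops" and pos: "\<And>y. 0 \<le> op_form m M y" for m M v
  proof -
    define y where "y i = (\<Sum>t<n. v i t *\<^sub>C x t)" for i
    have left: "cinner (M i k (y k)) w = (\<Sum>t<n. cinner (M i k (x t)) w * v k t)" for i k w
      by (simp add: y_def blinfun.sum_right bounded_ops_scaleC[OF M] cinner_sum_left
          cinner_scaleC_left mult.commute)
    have right: "cinner w (y i) = (\<Sum>s<n. cinner w (x s) * cnj (v i s))" for w i
      by (simp add: y_def cinner_sum_right cinner_scaleC_right mult.commute)
    have "cinner (M i k (y k)) (y i) = (\<Sum>s<n. \<Sum>t<n. cinner (M i k (x t)) (x s) * v k t * cnj (v i s))" for i k
      by (simp only: right left sum_distrib_right)
    then have "op_form m M y = block_form m n (\<lambda>i k s t. ?\<theta> (M i k, s, t)) v"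
      by (simp add: op_form_def block_form_def)
    then show ?thesis
      using pos[of y] by simp
  qed
  moreover have "cmod (?\<theta> (T, i, k)) \<le> norm T * Re (\<Sum>s<n. ?\<theta> (id_blinfun, s, s))" for T i k
  proof (cases "i < n \<and> k < n")
    case True
    have norms: "Re (\<Sum>s<n. ?\<theta> (id_blinfun, s, s)) = (\<Sum>s<n. (norm (x s))\<^sup>2)"
      by (simp add: cinner_self)
    \<comment> \<open>Bounding each square by the whole sum, and then averaging, covers
      \<open>i = k\<close> as well.\<close>
    have le: "(norm (x j))\<^sup>2 \<le> (\<Sum>s<n. (norm (x s))\<^sup>2)" if "j < n" for j
      using that by (intro member_le_sum) auto
    have "2 * (norm (x k) * norm (x i)) \<le> (norm (x k))\<^sup>2 + (norm (x i))\<^sup>2"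
      using sum_squares_bound[of "norm (x k)" "norm (x i)"] by simp
    then have prod: "norm (x k) * norm (x i) \<le> (\<Sum>s<n. (norm (x s))\<^sup>2)"
      using le[of i] le[of k] True by linarith
    have "cmod (cinner (T (x k)) (x i)) \<le> norm (T (x k)) * norm (x i)"
      by (rule cinner_bound)
    also have "\<dots> \<le> norm T * norm (x k) * norm (x i)"
      by (intro mult_right_mono norm_blinfun) simp
    also have "\<dots> \<le> norm T * (\<Sum>s<n. (norm (x s))\<^sup>2)"
      unfolding mult.assoc by (intro mult_left_mono prod) simp
    finally show ?thesis
      unfolding norms using True by simp
  qed (auto simp: cinner_self sum_nonneg)
  ultimately show ?thesis
    unfolding cp_cone_def by (auto simp: blinfun.add_left cinner_add_left cinner_scaleC_left)
qed

lemma ucp_map_of_cp_cone: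
  assumes \<theta>: "\<theta> \<in> cp_cone n" and unital: "\<And>i k. i < n \<Longrightarrow> k < n \<Longrightarrow> \<theta> (id_blinfun, i, k) = of_bool (i = k)"
    and C: "C \<subseteq> bounded_ops"
  shows "ucp_map C n (\<lambda>T. mat n n (\<lambda>(i, k). \<theta> (T, i, k)))"
  unfolding ucp_map_def
proof (intro conjI ballI allI impI)
  let ?\<phi> = "\<lambda>T. mat n n (\<lambda>(i, k). \<theta> (T, i, k))"
  show "?\<phi> (S + T) = ?\<phi> S + ?\<phi> T" for S T
    using \<theta> by (intro eq_matI) (auto simp: cp_cone_def)
  show "?\<phi> (op_scale c T) = c \<cdot>\<^sub>m ?\<phi> T" for c T
    using \<theta> by (intro eq_matI) (auto simp: cp_cone_def)
  show "?\<phi> id_blinfun = 1\<^sub>m n"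
    by (intro eq_matI) (auto simp: unital)
  show "mat_pos (m * n) (amplify m n ?\<phi> M)"
    if M: "M \<in> carrier_mat m m" "elements_mat M \<subseteq> C" "op_mat_pos m M" for m M
  proof -
    \<comment> \<open>Padding by zero: the cone condition asks for bounded operators at all indices,
      also beyond \<open>m\<close>.\<close>
    define M' where "M' i k = (if i < m \<and> k < m then M $$ (i, k) else 0)" for i k
    have "M' i k \<in> bounded_ops" for i k
    proof (cases "i < m \<and> k < m")
      case True
      then have "M $$ (i, k) \<in> elements_mat M"
        using M(1) by (intro elements_matI) auto
      then show ?thesis
        using True M(2) C by (auto simp: M'_def)
    qed (auto simp: M'_def cstar_zero[OF unital_cstar_subalgebra_bounded_ops])
    moreover have "op_form m M' x = op_form m (\<lambda>i k. M $$ (i, k)) x" for x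
      by (simp add: op_form_def M'_def)
    then have "0 \<le> op_form m M' x" for x
      using M by (simp add: op_mat_pos_iff)
    ultimately have "0 \<le> block_form m n (\<lambda>i k s t. \<theta> (M' i k, s, t)) v" for v
      using \<theta> unfolding cp_cone_def by blast
    then have "mat_pos (m * n) (mat (m * n) (m * n)
        (\<lambda>(k, l). (\<lambda>i k s t. \<theta> (M' i k, s, t)) (k div n) (l div n) (k mod n) (l mod n)))"
      using mat_pos_block_iff[of m n "\<lambda>i k s t. \<theta> (M' i k, s, t)"] by blast
    also have "mat (m * n) (m * n)
        (\<lambda>(k, l). (\<lambda>i k s t. \<theta> (M' i k, s, t)) (k div n) (l div n) (k mod n) (l mod n)) = amplify m n ?\<phi> M"
    proof (cases "n = 0")
      case False
      then show ?thesis
        unfolding amplify_def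
        by (intro cong_mat refl) (auto simp: M'_def less_mult_imp_div_less)
    qed (intro eq_matI, simp_all add: amplify_def)
    finally show ?thesis .
  qed
qed simp_all

section \<open>From a separating functional to a positive pencil\<close>

text \<open>Against a Hermitian \<open>w\<close>, the anti-Hermitian part of \<open>p\<close>
  contributes a purely imaginary number.\<close>

lemma Re_sum_hermitian_part:
  fixes w p :: "nat \<Rightarrow> nat \<Rightarrow> complex"
  assumes "\<And>i k. i < n \<Longrightarrow> k < n \<Longrightarrow> w i k = cnj (w k i)"
  shows "Re (\<Sum>i<n. \<Sum>k<n. (p i k + cnj (p k i)) / 2 * w i k) = Re (\<Sum>i<n. \<Sum>k<n. p i k * w i k)"
proof -
  let ?s = "\<Sum>i<n. \<Sum>k<n. p i k * w i k"
  have "(\<Sum>i<n. \<Sum>k<n. cnj (p k i) * w i k) = (\<Sum>k<n. \<Sum>i<n. cnj (p k i) * w i k)"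
    by (rule sum.swap)
  also have "\<dots> = (\<Sum>k<n. \<Sum>i<n. cnj (p k i * w k i))"
  proof (intro sum.cong refl)
    fix k i assume "k \<in> {..<n}" "i \<in> {..<n}"
    then show "cnj (p k i) * w i k = cnj (p k i * w k i)"
      using assms[of i k] by simp
  qed
  finally have swap: "(\<Sum>i<n. \<Sum>k<n. cnj (p k i) * w i k) = cnj ?s"
    by (simp only: cnj_sum)
  have "(\<Sum>i<n. \<Sum>k<n. (p i k + cnj (p k i)) / 2 * w i k) =
      (\<Sum>i<n. \<Sum>k<n. 1/2 * (p i k * w i k) + 1/2 * (cnj (p k i) * w i k))"
    by (intro sum.cong refl) (simp add: field_simps)
  also have "\<dots> = 1/2 * ?s + 1/2 * (\<Sum>i<n. \<Sum>k<n. cnj (p k i) * w i k)"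
    by (simp only: sum.distrib sum_distrib_left)
  finally show ?thesis
    unfolding swap by simp
qed

lemma sum_option_square:
  fixes g :: "'d::finite option \<Rightarrow> nat \<Rightarrow> nat \<Rightarrow> complex"
  shows "(\<Sum>(j, i, k)\<in>UNIV \<times> {..<n} \<times> {..<n}. g j i k) =
    (\<Sum>i<n. \<Sum>k<n. g None i k) + (\<Sum>j\<in>UNIV. \<Sum>i<n. \<Sum>k<n. g (Some j) i k)"
  by (simp add: sum.cartesian_product[symmetric] UNIV_option_conv sum.reindex)

lemma matrix_range_level_of_polar:
  fixes A :: "'d::finite \<Rightarrow> 'h::chilbert_space \<Rightarrow>\<^sub>L 'h"
  assumes A: "\<forall>j. A j \<in> bounded_ops"
    and zero: "(\<lambda>j. 0\<^sub>m l l) \<in> matrix_range_level l A" "1 \<le> l"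
    and X: "X \<in> mat_tuples n" "1 \<le> n"
    and sa: "sa \<Longrightarrow> (\<forall>j. op_adj (A j) = A j) \<and> X \<in> sa_mat_tuples n"
    and polar: "\<And>Y. Y \<in> mat_tuples n \<Longrightarrow> Y \<in> free_spectrahedron A \<Longrightarrow>
      (sa \<Longrightarrow> Y \<in> sa_mat_tuples n) \<Longrightarrow> mat_le (n * n) (mat_Re (kron_sum n n Y X)) (1\<^sub>m (n * n))"
  shows "X \<in> matrix_range_level n A"
proof (rule ccontr)
  assume X_notin: "X \<notin> matrix_range_level n A"
  \<comment> \<open>The finitely many coordinates to be matched: \<open>None\<close> stands for the
    identity and \<open>Some j\<close> for \<open>A j\<close>. The target values \<open>z\<close>
    are the entries of the identity matrix and of \<open>X j\<close>.\<close>
  define e where "e = (\<lambda>(j, i :: nat, k :: nat). (case j of None \<Rightarrow> id_blinfun | Some j \<Rightarrow> A j, i, k))"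
  define z where "z = (\<lambda>(j, i, k). case j of None \<Rightarrow> of_bool (i = k) | Some j \<Rightarrow> X j $$ (i, k))"
  define J where "J = (UNIV :: 'd option set) \<times> {..<n} \<times> {..<n}"
  \<comment> \<open>The diagonal positions at the identity, so that the \<open>J0\<close>-sum is the
    trace of the value at the identity, which bounds the elements of \<open>cp_cone\<close>.\<close>
  define J0 where "J0 = (\<lambda>s. (None :: 'd option, s, s)) ` {..<n}"
  have trace: "(\<Sum>b\<in>J0. \<theta> (e b)) = (\<Sum>s<n. \<theta> (id_blinfun, s, s))" for \<theta> :: "_ \<Rightarrow> complex"
    unfolding J0_def by (subst sum.reindex) (auto simp: inj_on_def e_def)
  have miss: "\<exists>b\<in>J. \<theta> (e b) \<noteq> z b" if \<theta>: "\<theta> \<in> cp_cone n" for \<theta>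
  proof (rule ccontr)
    assume "\<not> (\<exists>b\<in>J. \<theta> (e b) \<noteq> z b)"
    then have hit: "\<theta> (e (j, i, k)) = z (j, i, k)" if "i < n" "k < n" for j i k
      using that by (auto simp: J_def)
    have "\<theta> (id_blinfun, i, k) = of_bool (i = k)" if "i < n" "k < n" for i k
      using hit[OF that, of None] by (simp add: e_def z_def)
    moreover have "cstar_generated A \<subseteq> bounded_ops"
      using cstar_bounded_ops[OF unital_cstar_subalgebra_cstar_generated(1)[OF A]] by blast
    ultimately have "ucp_map (cstar_generated A) n (\<lambda>T. mat n n (\<lambda>(i, k). \<theta> (T, i, k)))"
      by (intro ucp_map_of_cp_cone[OF \<theta>])
    moreover have "X = (\<lambda>j. mat n n (\<lambda>(i, k). \<theta> (A j, i, k)))"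
    proof
      fix j
      have "\<theta> (A j, i, k) = X j $$ (i, k)" if "i < n" "k < n" for i k
        using hit[OF that, of "Some j"] by (simp add: e_def z_def)
      then show "X j = mat n n (\<lambda>(i, k). \<theta> (A j, i, k))"
        using X(1) by (intro eq_matI) (auto simp: mat_tuples_def)
    qed
    ultimately show False
      using X_notin by (auto simp: matrix_range_level_def)
  qed
  have bound: "cmod (\<theta> b) \<le> norm (fst b) * Re (\<Sum>j\<in>J0. \<theta> (e j))" if "\<theta> \<in> cp_cone n" for \<theta> b
    using that unfolding trace by (cases b) (simp add: cp_cone_def)
  have J: "finite J" "J0 \<subseteq> J"
    by (auto simp: J_def J0_def)
  obtain r where r: "\<And>\<theta>. \<theta> \<in> cp_cone n \<Longrightarrow> 0 \<le> Re (\<Sum>b\<in>J. r b * \<theta> (e b))"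
    and r_z: "Re (\<Sum>b\<in>J. r b * z b) < 0"
    by (rule cone_separation[OF closed_cp_cone zero_in_cp_cone add_in_cp_cone scale_in_cp_cone J
        norm_ge_zero bound miss]) blast+
  define p where "p i k = r (None, i, k)" for i k
  define q where "q j i k = r (Some j, i, k)" for j i k
  \<comment> \<open>The constant coefficients are paired with Gram matrices and with the identity,
    both Hermitian, so passing to the Hermitian part keeps the real parts. For \<open>L\<close> the
    same holds in the self-adjoint setting, where \<open>A j\<close> and \<open>X j\<close> are
    self-adjoint.\<close>
  define P where "P i k = (p i k + cnj (p k i)) / 2" for i k
  define L where "L j i k = (if sa then (q j i k + cnj (q j k i)) / 2 else q j i k)" for j i k
  have J_sum: "(\<Sum>b\<in>J. r b * g b) = (\<Sum>i<n. \<Sum>k<n. p i k * g (None, i, k)) +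
      (\<Sum>j\<in>UNIV. \<Sum>i<n. \<Sum>k<n. q j i k * g (Some j, i, k))" for g
    using sum_option_square[of "\<lambda>j i k. r (j, i, k) * g (j, i, k)" n]
    by (simp add: J_def p_def q_def case_prod_unfold)
  have P_sum: "Re (\<Sum>i<n. \<Sum>k<n. P i k * w i k) = Re (\<Sum>i<n. \<Sum>k<n. p i k * w i k)"
    if "\<And>i k. i < n \<Longrightarrow> k < n \<Longrightarrow> w i k = cnj (w k i)" for w
    unfolding P_def using that by (rule Re_sum_hermitian_part)
  have L_sum: "Re (\<Sum>i<n. \<Sum>k<n. L j i k * w i k) = Re (\<Sum>i<n. \<Sum>k<n. q j i k * w i k)"
    if "\<And>i k. sa \<Longrightarrow> i < n \<Longrightarrow> k < n \<Longrightarrow> w i k = cnj (w k i)" for w j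
  proof (cases sa)
    case True
    then show ?thesis
      unfolding L_def using Re_sum_hermitian_part[OF that] by simp
  qed (simp add: L_def)
  \<comment> \<open>The real part of the form at \<open>x\<close> is the separating functional
    evaluated at the compression by \<open>x\<close>.\<close>
  have "0 \<le> Re (op_form n (pencil P L A) x)" for x
  proof -
    have herm: "cinner (A j (x k)) (x i) = cnj (cinner (A j (x i)) (x k))" if sa for i j k
      using cinner_op_adj[of "A j" "x k" "x i"] cinner_commute[of "x k" "A j (x i)"] A sa[OF that] by simp
    have "Re (op_form n (pencil P L A) x) = Re (\<Sum>i<n. \<Sum>k<n. p i k * cinner (x k) (x i)) +
        (\<Sum>j\<in>UNIV. Re (\<Sum>i<n. \<Sum>k<n. q j i k * cinner (A j (x k)) (x i)))"
      unfolding op_form_pencil plus_complex.sel Re_sum[of _ UNIV]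
      by (intro arg_cong2[where f = "(+)"] sum.cong refl P_sum L_sum herm cinner_commute)
    also have "\<dots> = Re (\<Sum>b\<in>J. r b *
        (\<lambda>(T, i, k). if i < n \<and> k < n then cinner (blinfun_apply T (x k)) (x i) else 0) (e b))"
      by (simp add: J_sum e_def)
    also have "\<dots> \<ge> 0"
      by (intro r compression_in_cp_cone)
    finally show ?thesis .
  qed
  then have "0 \<le> Re (\<Sum>i<n. P i i) + Re (\<Sum>j\<in>UNIV. \<Sum>i<n. \<Sum>k<n. L j i k * X j $$ (i, k))"
    by (intro polar_pairing_nonneg[where sa = sa and P = P and L = L, OF A zero X(2) polar])
      (auto simp: P_def L_def add.commute)
  also have "Re (\<Sum>i<n. P i i) = Re (\<Sum>i<n. \<Sum>k<n. p i k * of_bool (i = k))"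
  proof -
    have "(\<Sum>i<n. P i i) = (\<Sum>i<n. \<Sum>k<n. if k = i then P i k else 0)"
      by simp
    also have "\<dots> = (\<Sum>i<n. \<Sum>k<n. P i k * of_bool (i = k))"
      by (intro sum.cong refl) auto
    also have "Re \<dots> = Re (\<Sum>i<n. \<Sum>k<n. p i k * of_bool (i = k))"
      by (rule P_sum) (auto simp: of_bool_def)
    finally show ?thesis .
  qed
  also have "Re (\<Sum>j\<in>UNIV. \<Sum>i<n. \<Sum>k<n. L j i k * X j $$ (i, k)) =
      Re (\<Sum>j\<in>UNIV. \<Sum>i<n. \<Sum>k<n. q j i k * X j $$ (i, k))"
  proof -
    have "X j $$ (i, k) = cnj (X j $$ (k, i))" if sa "i < n" "k < n" for i j k
      using sa[OF that(1)] that mat_adjoint_index[of "X j" n i k]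
      by (simp add: sa_mat_tuples_def mat_tuples_def)
    then show ?thesis
      unfolding Re_sum[of _ UNIV] by (intro sum.cong refl L_sum)
  qed
  finally show False
    using r_z by (simp add: J_sum z_def)
qed

theorem proposition3p3:
  fixes A :: "'d::finite \<Rightarrow> 'h::chilbert_space \<Rightarrow>\<^sub>L 'h"
  assumes "\<forall>j. A j \<in> bounded_ops"
    and "\<exists>n. (\<lambda>j. 0\<^sub>m n n) \<in> matrix_range A"
  shows "polar_dual (free_spectrahedron A) = matrix_range A \<and>
    ((\<forall>j. op_adj (A j) = A j) \<longrightarrow> sa_polar_dual (sa_free_spectrahedron A) = matrix_range A)"
proof -
  note A = assms(1)
  obtain n0 l where l: "1 \<le> l" "(\<lambda>j. 0\<^sub>m n0 n0) \<in> matrix_range_level l A"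
    using assms(2) by (auto simp: matrix_range_def)
  \<comment> \<open>The size of the zero tuple agrees with the size of the values of the map that
    produces it.\<close>
  have "n0 = l"
    using matrix_range_level_mat_tuples[OF A l(2)] by (auto simp: mat_tuples_def dest: carrier_matD)
  then have zero: "(\<lambda>j. 0\<^sub>m l l) \<in> matrix_range_level l A" "1 \<le> l"
    using l by simp_all
  have "polar_dual (free_spectrahedron A) = matrix_range A"
  proof (intro equalityI subsetI)
    fix X assume "X \<in> polar_dual (free_spectrahedron A)"
    then obtain n where n: "1 \<le> n" "X \<in> mat_tuples n" and
      polar: "\<And>Y. Y \<in> free_spectrahedron A \<inter> mat_tuples n \<Longrightarrow>
        mat_le (n * n) (mat_Re (kron_sum n n Y X)) (1\<^sub>m (n * n))"
      by (auto simp: polar_dual_def)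
    have "X \<in> matrix_range_level n A"
      using n polar by (intro matrix_range_level_of_polar[OF A zero, where sa = False]) auto
    then show "X \<in> matrix_range A"
      using n(1) by (auto simp: matrix_range_def)
  next
    fix X assume "X \<in> matrix_range A"
    then obtain n where "1 \<le> n" "X \<in> matrix_range_level n A"
      by (auto simp: matrix_range_def)
    then show "X \<in> polar_dual (free_spectrahedron A)"
      unfolding polar_dual_def
      using matrix_range_polar[OF A, of X n] matrix_range_level_mat_tuples[OF A, of X n] by blast
  qed
  moreover have "sa_polar_dual (sa_free_spectrahedron A) = matrix_range A" if sa: "\<forall>j. op_adj (A j) = A j"
  proof (intro equalityI subsetI)
    fix X assume "X \<in> sa_polar_dual (sa_free_spectrahedron A)"
    then obtain n where n: "1 \<le> n" "X \<in> sa_mat_tuples n" and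
      polar: "\<And>Y. Y \<in> sa_free_spectrahedron A \<inter> sa_mat_tuples n \<Longrightarrow>
        mat_le (n * n) (kron_sum n n Y X) (1\<^sub>m (n * n))"
      by (auto simp: sa_polar_dual_def)
    \<comment> \<open>On self-adjoint tuples both the spectrahedron and the polar inequality agree
      with their real-part versions, so the given inequalities have the form required with
      \<open>sa = True\<close>.\<close>
    have "mat_le (n * n) (mat_Re (kron_sum n n Y X)) (1\<^sub>m (n * n))"
      if "Y \<in> free_spectrahedron A" "Y \<in> sa_mat_tuples n" for Y
    proof -
      have "Y \<in> sa_free_spectrahedron A"
        using that sa_free_spectrahedron_iff[of A Y n] A sa n(1) by blast
      then show ?thesis
        using polar that(2) sa_polar_condition_iff[OF that(2) n(2)] by blast
    qed
    then have "X \<in> matrix_range_level n A"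
      using n sa
      by (intro matrix_range_level_of_polar[OF A zero, where sa = True]) (auto simp: sa_mat_tuples_def)
    then show "X \<in> matrix_range A"
      using n(1) by (auto simp: matrix_range_def)
  next
    fix X assume "X \<in> matrix_range A"
    then obtain n where n: "1 \<le> n" "X \<in> matrix_range_level n A"
      by (auto simp: matrix_range_def)
    have X: "X \<in> sa_mat_tuples n"
      by (rule matrix_range_level_sa_mat_tuples[OF A sa n(2)])
    have "mat_le (m * n) (kron_sum m n Y X) (1\<^sub>m (m * n))"
      if "1 \<le> m" "Y \<in> sa_free_spectrahedron A" "Y \<in> sa_mat_tuples m" for m Y
    proof -
      have "Y \<in> free_spectrahedron A \<inter> mat_tuples m"
        using that sa_free_spectrahedron_iff[of A Y m] A sa by (auto simp: sa_mat_tuples_def)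
      then show ?thesis
        using matrix_range_polar[OF A n(2) _ that(1)] sa_polar_condition_iff[OF that(3) X] by blast
    qed
    then show "X \<in> sa_polar_dual (sa_free_spectrahedron A)"
      unfolding sa_polar_dual_def using n(1) X by blast
  qed
  ultimately show ?thesis
    by blast
qed

end
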